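(* For $n\ge 1$, let $Z_{4;\mathrm{sc}}(n)$ be the number of equivalence classes of 4-tuples $(\sigma_1,\dots,\sigma_4)\in (S_n)^{\times 4}$ under the equivalence relation generated by $$(\sigma_1,\dots,\sigma_4)\sim(\gamma_1\sigma_1\gamma_2,\dots,\gamma_1\sigma_4\gamma_2)\quad(\gamma_1,\gamma_2\in S_n),\qquad (\sigma_1,\dots,\sigma_4)\sim(\sigma_{\alpha(1)},\dots,\sigma_{\alpha(4)})\quad(\alpha\in S_4).$$ Then $$Z_{4;\mathrm{sc}}(n)=\tfrac1{24}S^{(4)}_{[1^4]}(n)+\tfrac14S^{(4)}_{[2,1^2]}(n)+\tfrac13S^{(4)}_{[3,1]}(n)+\tfrac18S^{(4)}_{[2^2]}(n)+\tfrac14S^{(4)}_{[4]}(n),$$ where $$S^{(4)}_{[1^4]}(n)=\frac1{n!}\sum_{\gamma,\sigma_2,\sigma_3,\sigma_4\in S_n}\prod_{a=2}^4\delta(\gamma^{-1}\sigma_a\gamma\sigma_a^{-1})=\sum_{p\vdash n}(\mathrm{Sym}(p))^2,$$ $$S^{(4)}_{[2,1^2]}(n)=\frac1{n!}\sum_{\gamma,\sigma_1,\sigma_2\in S_n}\delta(\gamma\sigma_1\gamma^{-1}\sigma_1^{-1})\delta(\gamma^2\sigma_2\gamma^{-2}\sigma_2^{-1})$$ $$\qquad=\sum_{p\vdash n}\Big[\prod_{j=1}^{\lfloor n/2\rfloor}(2j)^{2p_{4j}}(2p_{4j})!\Big]\Big[\prod_{j=0}^{\lfloor n/2\rfloor}(2j+1)^{p_{2j+1}+2p_{4j+2}}(p_{2j+1}+2p_{4j+2})!\Big],$$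 $$S^{(4)}_{[3,1]}(n)=\frac1{n!}\sum_{\gamma,\sigma\in S_n}\delta(\gamma^3\sigma\gamma^{-3}\sigma^{-1})=\sum_{p\vdash n}\mathrm{Coeff}\big[Z^{(3)}(t,\vec x),t^nx_1^{p_1}\cdots x_n^{p_n}\big]\,\mathrm{Sym}(p),$$ $$S^{(4)}_{[2^2]}(n)=\frac1{n!}\sum_{\gamma,\sigma_1,\sigma_2\in S_n}\delta(\sigma_1^2\gamma^2)\delta(\gamma^2\sigma_2\gamma^{-2}\sigma_2^{-1})=\sum_{p\vdash n}\Big(\mathrm{Coeff}\big[Z^{(2)}(t,\vec x),t^nx_1^{p_1}\cdots x_n^{p_n}\big]\,\mathrm{Sym}(p)\Big)^2,$$ $$S^{(4)}_{[4]}(n)=\frac1{n!}\sum_{\gamma,\sigma\in S_n}\delta(\sigma^4\gamma^4)=\sum_{p\vdash n}\Big(\mathrm{Coeff}\big[Z^{(4)}(t,\vec x),t^nx_1^{p_1}\cdots x_n^{p_n}\big]\Big)^2\,\mathrm{Sym}(p).$$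
   Context: $S_n$ is the symmetric group on $\{1,\dots,n\}$; $\delta$ is the function on $S_n$ equal to $1$ at the identity and $0$ elsewhere. A partition $p\vdash n$ is written $p=(p_1,\dots,p_n)$ with $p_i$ the number of parts equal to $i$, $\sum_i ip_i=n$ (and $p_i=0$ for $i>n$), and $\mathrm{Sym}(p)=\prod_{i=1}^n i^{p_i}p_i!$. $\mathrm{Coeff}[F,m]$ is the coefficient of the monomial $m$ in the formal power series $F$. With $\vec x=(x_1,x_2,\dots)$ let $Z^{(1)}(t,\vec x)=\exp\big(\sum_{i\ge1}t^ix_i/i\big)$. The following are obtained from $Z^{(1)}(t,\vec x)$ by simultaneous substitutions of the variables: $Z^{(2)}$ by $x_i\to (x_{i/2})^2$ for $i$ even (other $x_i$ unchanged); $Z^{(3)}$ by $x_i\to(x_{i/3})^3$ for $i$ divisible by 3 (other $x_i$ unchanged); $Z^{(4)}$ by $x_i\to(x_{i/4})^4$ for $i\equiv0\pmod 4$, $x_i\to(x_{i/2})^2$ for $i\equiv 2\pmod 4$, and $x_i$ unchanged for $i$ odd. *)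

theory Defs
  imports
    "HOL-Library.FuncSet"
    "HOL-Library.Poly_Mapping"
    "HOL-Combinatorics.Permutations"
    "HOL-Computational_Algebra.Formal_Power_Series"
begin

section \<open>The symmetric group and tuples of permutations\<close>

definition perms :: "nat \<Rightarrow> (nat \<Rightarrow> nat) set" where
  "perms n = {\<sigma>. \<sigma> permutes {1..n}}"

definition perm_delta :: "(nat \<Rightarrow> nat) \<Rightarrow> rat" where
  "perm_delta \<sigma> = (if \<sigma> = id then 1 else 0)"

definition tuples :: "nat \<Rightarrow> (nat \<Rightarrow> nat \<Rightarrow> nat) set" where
  "tuples n = {1..4} \<rightarrow>\<^sub>E perms n"

inductive sc_step :: "nat \<Rightarrow> (nat \<Rightarrow> nat \<Rightarrow> nat) \<Rightarrow> (nat \<Rightarrow> nat \<Rightarrow> nat) \<Rightarrow> bool" for n where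
  left_right: "\<lbrakk>\<sigma> \<in> tuples n; \<gamma>\<^sub>1 \<in> perms n; \<gamma>\<^sub>2 \<in> perms n\<rbrakk>
    \<Longrightarrow> sc_step n \<sigma> (\<lambda>a\<in>{1..4}. \<gamma>\<^sub>1 \<circ> \<sigma> a \<circ> \<gamma>\<^sub>2)"
| recolour: "\<lbrakk>\<sigma> \<in> tuples n; \<alpha> permutes {1..4}\<rbrakk>
    \<Longrightarrow> sc_step n \<sigma> (\<lambda>a\<in>{1..4}. \<sigma> (\<alpha> a))"

definition sc_equiv :: "nat \<Rightarrow> ((nat \<Rightarrow> nat \<Rightarrow> nat) \<times> (nat \<Rightarrow> nat \<Rightarrow> nat)) set" where
  "sc_equiv n = {(\<sigma>, \<tau>) \<in> tuples n \<times> tuples n. equivclp (sc_step n) \<sigma> \<tau>}"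

definition Z4_sc :: "nat \<Rightarrow> nat" where
  "Z4_sc n = card (tuples n // sc_equiv n)"

section \<open>The sums over the symmetric group\<close>

definition S4_1_1_1_1 :: "nat \<Rightarrow> rat" where
  "S4_1_1_1_1 n = 1 / fact n * (\<Sum>\<gamma>\<in>perms n. \<Sum>\<sigma>\<in>{2..4::nat} \<rightarrow>\<^sub>E perms n.
     \<Prod>a=2..4. perm_delta (inv \<gamma> \<circ> \<sigma> a \<circ> \<gamma> \<circ> inv (\<sigma> a)))"

definition S4_2_1_1 :: "nat \<Rightarrow> rat" where
  "S4_2_1_1 n = 1 / fact n * (\<Sum>\<gamma>\<in>perms n. \<Sum>\<sigma>\<^sub>1\<in>perms n. \<Sum>\<sigma>\<^sub>2\<in>perms n.
     perm_delta (\<gamma> \<circ> \<sigma>\<^sub>1 \<circ> inv \<gamma> \<circ> inv \<sigma>\<^sub>1) *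
     perm_delta (\<gamma> ^^ 2 \<circ> \<sigma>\<^sub>2 \<circ> inv \<gamma> ^^ 2 \<circ> inv \<sigma>\<^sub>2))"

definition S4_3_1 :: "nat \<Rightarrow> rat" where
  "S4_3_1 n = 1 / fact n * (\<Sum>\<gamma>\<in>perms n. \<Sum>\<sigma>\<in>perms n.
     perm_delta (\<gamma> ^^ 3 \<circ> \<sigma> \<circ> inv \<gamma> ^^ 3 \<circ> inv \<sigma>))"

definition S4_2_2 :: "nat \<Rightarrow> rat" where
  "S4_2_2 n = 1 / fact n * (\<Sum>\<gamma>\<in>perms n. \<Sum>\<sigma>\<^sub>1\<in>perms n. \<Sum>\<sigma>\<^sub>2\<in>perms n.
     perm_delta (\<sigma>\<^sub>1 ^^ 2 \<circ> \<gamma> ^^ 2) *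
     perm_delta (\<gamma> ^^ 2 \<circ> \<sigma>\<^sub>2 \<circ> inv \<gamma> ^^ 2 \<circ> inv \<sigma>\<^sub>2))"

definition S4_4 :: "nat \<Rightarrow> rat" where
  "S4_4 n = 1 / fact n * (\<Sum>\<gamma>\<in>perms n. \<Sum>\<sigma>\<in>perms n. perm_delta (\<sigma> ^^ 4 \<circ> \<gamma> ^^ 4))"

section \<open>Partitions\<close>

text \<open>A partition is given by its multiplicities, as a finitely supported function, so
  that it is at the same time the exponent vector of the monomial
  \<open>x\<^sub>1^p\<^sub>1 \<dots> x\<^sub>n^p\<^sub>n\<close>.\<close>

definition partitions :: "nat \<Rightarrow> (nat \<Rightarrow>\<^sub>0 nat) set" where
  "partitions n = {p. Poly_Mapping.keys p \<subseteq> {1..n} \<and> (\<Sum>i=1..n. i * Poly_Mapping.lookup p i) = n}"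

definition Sym :: "nat \<Rightarrow> (nat \<Rightarrow>\<^sub>0 nat) \<Rightarrow> rat" where
  "Sym n p = (\<Prod>i=1..n. of_nat i ^ Poly_Mapping.lookup p i * fact (Poly_Mapping.lookup p i))"

section \<open>The generating series\<close>

text \<open>Polynomials over the rationals in the variables \<open>x\<^sub>0, x\<^sub>1, x\<^sub>2, \<dots>\<close> (\<open>x\<^sub>0\<close> does not
  occur in the series below). In each of the series the coefficient of \<open>t^n\<close> is a
  polynomial, so they are formal power series in \<open>t\<close> over the polynomial ring.\<close>

type_synonym xpoly = "(nat \<Rightarrow>\<^sub>0 nat) \<Rightarrow>\<^sub>0 rat"

definition xconst :: "rat \<Rightarrow> xpoly" where
  "xconst c = Poly_Mapping.single 0 c"

definition xvar :: "nat \<Rightarrow> xpoly" where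
  "xvar i = Poly_Mapping.single (Poly_Mapping.single i 1) 1"

definition xsubst :: "(nat \<Rightarrow> xpoly) \<Rightarrow> xpoly \<Rightarrow> xpoly" where
  "xsubst f P = (\<Sum>m\<in>Poly_Mapping.keys P. xconst (Poly_Mapping.lookup P m) *
     (\<Prod>i\<in>Poly_Mapping.keys m. f i ^ Poly_Mapping.lookup m i))"

definition series_subst :: "(nat \<Rightarrow> xpoly) \<Rightarrow> xpoly fps \<Rightarrow> xpoly fps" where
  "series_subst f F = Abs_fps (\<lambda>n. xsubst f (fps_nth F n))"

text \<open>The library's exponential series requires coefficients in a field. The composition
  below is meaningful for series \<open>F\<close> with zero constant term.\<close>

definition series_exp :: "xpoly fps \<Rightarrow> xpoly fps" where
  "series_exp F = fps_compose (Abs_fps (\<lambda>k. xconst (1 / fact k))) F"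

definition Z1 :: "xpoly fps" where
  "Z1 = series_exp (Abs_fps (\<lambda>i. if i = 0 then 0 else xconst (1 / of_nat i) * xvar i))"

definition Z2 :: "xpoly fps" where
  "Z2 = series_subst (\<lambda>i. if even i then xvar (i div 2) ^ 2 else xvar i) Z1"

definition Z3 :: "xpoly fps" where
  "Z3 = series_subst (\<lambda>i. if 3 dvd i then xvar (i div 3) ^ 3 else xvar i) Z1"

definition Z4 :: "xpoly fps" where
  "Z4 = series_subst (\<lambda>i. if i mod 4 = 0 then xvar (i div 4) ^ 4
                          else if i mod 4 = 2 then xvar (i div 2) ^ 2 else xvar i) Z1"

definition Coeff :: "xpoly fps \<Rightarrow> nat \<Rightarrow> (nat \<Rightarrow>\<^sub>0 nat) \<Rightarrow> rat" where
  "Coeff F n p = Poly_Mapping.lookup (fps_nth F n) p"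

end

(*
  The classes are the orbits of S_4 x S_n x S_n on quadruples, so Burnside's lemma applies.
  The quadruples fixed by (alpha, a, b) are the equivariant maps from ({1..4}, alpha) to S_n
  with the bijection u |-> a^-1 u b^-1. Such a map is determined by its values on one point of
  each cycle, and a cycle of length i may be sent to any u with a^i u b^i = u. These u are the
  permutations conjugating b^-i to a^i: there are Sym(p) of them if a^i and b^i have the same
  cycle type p, and none otherwise. Hence only the cycle types of a, b and alpha matter, and the
  sum over the five cycle types of alpha gives the five terms.

  Writing e_i for the partition with the single part i, n/Sym(p) is the sum of
  i p_i/Sym(p) = 1/Sym(p - e_i) over the parts i of p. This is the recursion that the
  differential equation Z' = (sum_i x_i t^(i-1)) Z gives for the coefficients of Z1, which are
  therefore 1/Sym(p). A k-th power breaks an i-cycle into gcd(i,k) cycles of length i/gcd(i,k),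
  and Z2, Z3, Z4 are Z1 with x_i replaced by the monomial of that cycle type; so
  n! Coeff(Zk, p) counts the permutations whose k-th power has cycle type p.
*)
theory Submission
  imports Defs "HOL-Combinatorics.Cycles" "HOL-Combinatorics.Orbits"
begin

section \<open>Equivariant maps\<close>

text \<open>Cycles are never formed as objects. A cycle length is the \<open>least_power\<close> of
  a point, and the inductions delete one orbit from an invariant subset while the permutation of the
  whole type stays the same; for this reason the counting lemmas speak of invariant subsets
  \<open>A\<close> and \<open>X\<close>.

  Two counts of the proof are one problem about equivariant maps: the quadruples fixed by a group
  element are all equivariant maps from {1..4}, and the permutations conjugating one permutation to
  another are the bijective ones between two copies of {1..n}.

  That every partition of n is a cycle type is obtained without a construction: class sizes are
  bounded by n!/Sym(p), and these bounds have the right total. The sum of all 1/Sym(p) must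
  therefore be known beforehand; it comes from the same removal of a part as the coefficients of Z1.

  The sums S are not matched with the terms of Burnside's lemma one delta function at a time. Both
  sides are evaluated as sums over partitions and agree there.\<close>

definition equivariant_maps ::
    "'a set \<Rightarrow> ('a \<Rightarrow> 'a) \<Rightarrow> 'b set \<Rightarrow> ('b \<Rightarrow> 'b) \<Rightarrow> ('a \<Rightarrow> 'b) set" where
  "equivariant_maps A s X T = {f \<in> A \<rightarrow>\<^sub>E X. \<forall>a\<in>A. f (s a) = T (f a)}"

definition intertwiners ::
    "'a set \<Rightarrow> ('a \<Rightarrow> 'a) \<Rightarrow> 'b set \<Rightarrow> ('b \<Rightarrow> 'b) \<Rightarrow> ('a \<Rightarrow> 'b) set" where
  "intertwiners A s X T = {f \<in> equivariant_maps A s X T. bij_betw f A X}"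

definition period_set :: "'a set \<Rightarrow> ('a \<Rightarrow> 'a) \<Rightarrow> nat \<Rightarrow> 'a set" where
  "period_set A s i = {x \<in> A. least_power s x = i}"

text \<open>The division is exact on a finite invariant set, because the points of period i fall
  into orbits of size i (\<open>dvd_card_period_set\<close>). For i = 0 it returns 0.\<close>

definition num_cycles :: "'a set \<Rightarrow> ('a \<Rightarrow> 'a) \<Rightarrow> nat \<Rightarrow> nat" where
  "num_cycles A s i = card (period_set A s i) div i"

section \<open>Orbits and periods of a permutation\<close>

lemma orbit_eq_image_least_power:
  assumes "permutation s"
  shows "orbit s a = (\<lambda>i. (s ^^ i) a) ` {..<least_power s a}"
proof -
  have "orbit s a = {(s ^^ m) a |m. m < least_power s a}"
    using orbit_altdef_bounded[OF least_power_of_permutation[OF assms]] .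
  then show ?thesis by (auto simp: image_def)
qed

lemma card_orbit_eq_least_power:
  assumes "permutation s"
  shows "card (orbit s a) = least_power s a"
proof -
  have "inj_on (\<lambda>i. (s ^^ i) a) {..<least_power s a}"
    using cycle_of_permutation[OF assms, of a]
    by (auto simp: distinct_map atLeast0LessThan)
  then show ?thesis
    by (simp add: orbit_eq_image_least_power[OF assms] card_image)
qed

lemma orbit_eq_of_mem:
  assumes "permutation s" "x \<in> orbit s a"
  shows "orbit s x = orbit s a"
  using orbit_cyclic_eq3[OF cyclic_on_orbit'[OF assms(1)] assms(2)] .

lemma least_power_orbit:
  assumes "permutation s" "x \<in> orbit s a"
  shows "least_power s x = least_power s a"
  using orbit_eq_of_mem[OF assms] card_orbit_eq_least_power[OF assms(1)] by metis

lemma orbit_subset_invariant: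
  assumes "s ` A \<subseteq> A" "a \<in> A"
  shows "orbit s a \<subseteq> A"
proof
  fix x assume "x \<in> orbit s a"
  then show "x \<in> A" by induction (use assms in auto)
qed

lemma Diff_orbit_invariant:
  assumes "permutation s" "s ` A \<subseteq> A"
  shows "s ` (A - orbit s a) \<subseteq> A - orbit s a"
proof -
  have "x \<in> orbit s a" if "s x \<in> orbit s a" for x
    using orbit_eq_of_mem[OF assms(1) that] permutation_orbit_step[OF assms(1), of x]
      permutation_self_in_orbit[OF assms(1), of x] by simp
  then show ?thesis using assms(2) by blast
qed

lemma period_set_Diff_orbit:
  assumes "permutation s"
  shows "period_set (A - orbit s a) s i =
    (if i = least_power s a then period_set A s i - orbit s a else period_set A s i)"
  using least_power_orbit[OF assms] by (auto simp: period_set_def)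

lemma card_period_set_Diff_orbit:
  assumes "permutation s" "s ` A \<subseteq> A" "a \<in> A" "finite A"
  shows "card (period_set A s i) =
    card (period_set (A - orbit s a) s i) + (if i = least_power s a then i else 0)"
proof (cases "i = least_power s a")
  case True
  have sub: "orbit s a \<subseteq> period_set A s i"
    using orbit_subset_invariant[OF assms(2,3)] least_power_orbit[OF assms(1)] True
    by (auto simp: period_set_def)
  have fin: "finite (period_set A s i)" using assms(4) by (simp add: period_set_def)
  have "card (period_set A s i - orbit s a) = card (period_set A s i) - i"
    using card_Diff_subset[OF finite_subset[OF sub fin] sub] card_orbit_eq_least_power[OF assms(1)]
      True by simp
  moreover have "i \<le> card (period_set A s i)"
    using card_mono[OF fin sub] card_orbit_eq_least_power[OF assms(1)] True by simp
  ultimately show ?thesis using True by (simp add: period_set_Diff_orbit[OF assms(1)])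
qed (simp add: period_set_Diff_orbit[OF assms(1)])

lemma card_Diff_orbit_less:
  assumes "permutation s" "a \<in> A" "finite A"
  shows "card (A - orbit s a) < card A"
  using assms permutation_self_in_orbit[OF assms(1), of a] by (intro psubset_card_mono) auto

lemma dvd_card_period_set:
  assumes "permutation s" "s ` A \<subseteq> A" "finite A"
  shows "i dvd card (period_set A s i)"
  using assms(2,3)
proof (induction "card A" arbitrary: A rule: less_induct)
  case less
  show ?case
  proof (cases "A = {}")
    case False
    then obtain a where a: "a \<in> A" by blast
    have "i dvd card (period_set (A - orbit s a) s i)"
      by (rule less.hyps[OF card_Diff_orbit_less[OF assms(1) a less.prems(2)]
            Diff_orbit_invariant[OF assms(1) less.prems(1)]]) (use less.prems in simp)
    then show ?thesis
      by (simp add: card_period_set_Diff_orbit[OF assms(1) less.prems(1) a less.prems(2)])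
  qed (simp add: period_set_def)
qed

lemma card_period_set:
  assumes "permutation s" "s ` A \<subseteq> A" "finite A"
  shows "card (period_set A s i) = i * num_cycles A s i"
  using dvd_card_period_set[OF assms, of i] by (simp add: num_cycles_def)

lemma num_cycles_Diff_orbit:
  assumes "permutation s" "s ` A \<subseteq> A" "a \<in> A" "finite A"
  shows "num_cycles A s i =
    num_cycles (A - orbit s a) s i + (if i = least_power s a then 1 else 0)"
  using card_period_set_Diff_orbit[OF assms, of i] least_power_of_permutation(2)[OF assms(1), of a]
  by (auto simp: num_cycles_def)

section \<open>Counting equivariant maps\<close>

lemma equivariant_funpow:
  assumes "f \<in> equivariant_maps A s X T" "s ` A \<subseteq> A" "a \<in> A"
  shows "f ((s ^^ m) a) = (T ^^ m) (f a)"
proof -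
  have "(s ^^ m) a \<in> A \<and> f ((s ^^ m) a) = (T ^^ m) (f a)"
    by (induction m) (use assms in \<open>auto simp: equivariant_maps_def\<close>)
  then show ?thesis ..
qed

text \<open>On the orbit of \<open>a\<close> an equivariant map is forced by its value b at
  \<open>a\<close>, since s^m a must go to T^m b. This is consistent exactly when T^p b = b, where p
  is the length of the orbit, and it puts no constraint on the complement, which is itself
  invariant.\<close>

lemma bij_betw_peel_orbit:
  assumes s: "permutation s" "s ` A \<subseteq> A" "a \<in> A" and T: "T ` X \<subseteq> X"
  shows "bij_betw (\<lambda>f. (f a, restrict f (A - orbit s a))) (equivariant_maps A s X T)
    ({b \<in> X. (T ^^ least_power s a) b = b} \<times> equivariant_maps (A - orbit s a) s X T)"
    (is "bij_betw ?F ?E (?X \<times> ?E')")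
proof (rule bij_betw_imageI)
  have OA: "orbit s a \<subseteq> A" by (rule orbit_subset_invariant[OF s(2,3)])
  have inv: "s ` (A - orbit s a) \<subseteq> A - orbit s a" by (rule Diff_orbit_invariant[OF s(1,2)])
  show "inj_on ?F ?E"
  proof (rule inj_onI)
    fix f g assume f: "f \<in> ?E" and g: "g \<in> ?E" and eq: "?F f = ?F g"
    have "f x = g x" if "x \<in> A" for x
    proof (cases "x \<in> orbit s a")
      case True
      then obtain m where "x = (s ^^ m) a" by (auto simp: orbit_altdef)
      then show ?thesis
        using equivariant_funpow[OF f s(2,3)] equivariant_funpow[OF g s(2,3)] eq by simp
    next
      case False
      then show ?thesis using eq that by (metis DiffI Pair_inject restrict_apply')
    qed
    then show "f = g"
      using f g by (intro PiE_ext[of f A "\<lambda>_. X" g]) (auto simp: equivariant_maps_def)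
  qed
  show "?F ` ?E = ?X \<times> ?E'"
  proof (intro equalityI subsetI)
    fix y assume "y \<in> ?F ` ?E"
    then obtain f where f: "f \<in> ?E" and y: "y = ?F f" by blast
    have "(T ^^ least_power s a) (f a) = f a"
      using equivariant_funpow[OF f s(2,3), of "least_power s a"]
        least_power_of_permutation(1)[OF s(1)] by simp
    moreover have "restrict f (A - orbit s a) \<in> ?E'"
      using f inv by (auto simp: equivariant_maps_def image_subset_iff)
    ultimately show "y \<in> ?X \<times> ?E'"
      using f s(3) y by (auto simp: equivariant_maps_def)
  next
    fix y assume "y \<in> ?X \<times> ?E'"
    then obtain b g where y: "y = (b, g)" and b: "b \<in> X" "(T ^^ least_power s a) b = b"
      and g: "g \<in> ?E'" by auto
    \<comment> \<open>Some exponent leading from \<open>a\<close> to \<open>x\<close>. Which one is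
      chosen does not matter: by \<open>Teq\<close>, two such exponents agree modulo the period of
      \<open>a\<close>, and T raised to that period fixes \<open>b\<close>.\<close>
    define d where "d x = (SOME m. (s ^^ m) a = x)" for x
    have d: "(s ^^ d x) a = x" if "x \<in> orbit s a" for x
    proof -
      from that obtain m where "(s ^^ m) a = x" by (auto simp: orbit_altdef)
      then show ?thesis unfolding d_def by (rule someI)
    qed
    have Teq: "(T ^^ m) b = (T ^^ k) b" if "(s ^^ m) a = (s ^^ k) a" for m k
    proof -
      let ?p = "least_power s a"
      have p: "(s ^^ ?p) a = a" "?p > 0" using least_power_of_permutation[OF s(1)] by auto
      have "(s ^^ (m mod ?p)) a = (s ^^ (k mod ?p)) a"
        using that by (simp add: funpow_mod_eq[OF p(1)])
      moreover have "inj_on (\<lambda>i. (s ^^ i) a) {..<?p}"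
        using cycle_of_permutation[OF s(1), of a] by (auto simp: distinct_map atLeast0LessThan)
      ultimately have "m mod ?p = k mod ?p"
        using p(2) by (auto dest: inj_onD)
      then show ?thesis
        using funpow_mod_eq[OF b(2), of m] funpow_mod_eq[OF b(2), of k] by simp
    qed
    have TX: "(T ^^ m) b \<in> X" for m by (induction m) (use b T in auto)
    define f where "f = (\<lambda>x\<in>A. if x \<in> orbit s a then (T ^^ d x) b else g x)"
    have fa: "f a = b"
    proof -
      have "(s ^^ d a) a = (s ^^ 0) a" using d[OF permutation_self_in_orbit[OF s(1), of a]] by simp
      from Teq[OF this] show ?thesis
        using s(3) permutation_self_in_orbit[OF s(1), of a] by (simp add: f_def)
    qed
    have "f (s x) = T (f x)" if x: "x \<in> A" for x
    proof (cases "x \<in> orbit s a")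
      case True
      then have sx: "s x \<in> orbit s a" by (rule orbit.step)
      have "(s ^^ d (s x)) a = (s ^^ Suc (d x)) a" using d[OF True] d[OF sx] by simp
      from Teq[OF this] show ?thesis using True sx x OA by (auto simp: f_def)
    next
      case False
      then have "s x \<in> A - orbit s a" using inv x by blast
      then show ?thesis using False x g by (auto simp: f_def equivariant_maps_def)
    qed
    moreover have "f \<in> A \<rightarrow>\<^sub>E X" using g TX by (auto simp: f_def equivariant_maps_def)
    ultimately have "f \<in> ?E" by (simp add: equivariant_maps_def)
    moreover have "restrict f (A - orbit s a) = g"
      using g by (intro ext) (auto simp: f_def restrict_def equivariant_maps_def PiE_def extensional_def)
    ultimately show "y \<in> ?F ` ?E" using fa y by force
  qed
qed

text \<open>Induction on the size of \<open>A\<close>: deleting an orbit of length p removes one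
  factor with index p and lowers the number of p-cycles by one. \<open>I\<close> is any finite set
  containing the cycle lengths, so that it need not change while \<open>A\<close> shrinks.\<close>

lemma card_equivariant_maps:
  assumes "permutation s" "s ` A \<subseteq> A" "finite A" and T: "T ` X \<subseteq> X"
    and "finite I" "least_power s ` A \<subseteq> I"
  shows "card (equivariant_maps A s X T) =
    (\<Prod>i\<in>I. card {x \<in> X. (T ^^ i) x = x} ^ num_cycles A s i)"
  using assms(2,3,6)
proof (induction "card A" arbitrary: A rule: less_induct)
  case less
  show ?case
  proof (cases "A = {}")
    case True
    then show ?thesis by (simp add: equivariant_maps_def num_cycles_def period_set_def)
  next
    case False
    then obtain a where a: "a \<in> A" by blast
    let ?c = "\<lambda>i. card {x \<in> X. (T ^^ i) x = x}" and ?B = "A - orbit s a" and ?p = "least_power s a"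
    have IH: "card (equivariant_maps ?B s X T) = (\<Prod>i\<in>I. ?c i ^ num_cycles ?B s i)"
      by (rule less.hyps[OF card_Diff_orbit_less[OF assms(1) a less.prems(2)]
            Diff_orbit_invariant[OF assms(1) less.prems(1)]]) (use less.prems in auto)
    have "card (equivariant_maps A s X T) = ?c ?p * card (equivariant_maps ?B s X T)"
      using bij_betw_same_card[OF bij_betw_peel_orbit[OF assms(1) less.prems(1) a T]]
      by (simp add: card_cartesian_product)
    \<comment> \<open>Written as a product over \<open>I\<close>, the single factor merges with the
      induction hypothesis index by index.\<close>
    also have "?c ?p = (\<Prod>i\<in>I. ?c i ^ (if i = ?p then 1 else 0))"
    proof -
      have "?p \<in> I" using a less.prems by blast
      then show ?thesis using assms(5) by (simp add: if_distrib[of "\<lambda>e. _ ^ e"] prod.delta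
          del: One_nat_def cong: if_cong)
    qed
    finally show ?thesis
      unfolding IH prod.distrib[symmetric]
      by (simp add: num_cycles_Diff_orbit[OF assms(1) less.prems(1) a less.prems(2)]
          power_add mult.commute)
  qed
qed

section \<open>Equivariant bijections and cycle types\<close>

lemma equivariant_bij_least_power:
  assumes "f \<in> equivariant_maps A s X T" "inj_on f A" "s ` A \<subseteq> A" "a \<in> A"
  shows "least_power T (f a) = least_power s a"
proof -
  have "(s ^^ m) a \<in> A" for m by (induction m) (use assms in auto)
  \<comment> \<open>Equivariance gives one direction, injectivity of \<open>f\<close> the other:
    both points have the same return times.\<close>
  then have "(T ^^ m) (f a) = f a \<longleftrightarrow> (s ^^ m) a = a" for m
    using equivariant_funpow[OF assms(1,3,4), of m] assms(2,4)
    by (metis inj_on_def)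
  then show ?thesis by (simp add: least_power_def)
qed

lemma equivariant_image_orbit:
  assumes "f \<in> equivariant_maps A s X T" "permutation s" "permutation T" "s ` A \<subseteq> A" "a \<in> A"
  shows "f ` orbit s a = orbit T (f a)"
  using equivariant_funpow[OF assms(1,4,5)]
  by (simp add: orbit_altdef_permutation[OF assms(2)] orbit_altdef_permutation[OF assms(3)]
      full_SetCompr_eq image_image)

text \<open>A bijection must preserve the period of \<open>a\<close> and must send the rest of
  \<open>A\<close> onto the complement of the orbit of \<open>f a\<close>. The codomain of the
  restricted map thus depends on the chosen value, hence the dependent sum. The bijection is the one
  for all equivariant maps, cut down to a subset.\<close>

lemma bij_betw_peel_orbit_intertwiners:
  assumes s: "permutation s" "s ` A \<subseteq> A" "a \<in> A" and T: "permutation T" "T ` X \<subseteq> X"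
  shows "bij_betw (\<lambda>f. (f a, restrict f (A - orbit s a))) (intertwiners A s X T)
    (SIGMA b : period_set X T (least_power s a).
       intertwiners (A - orbit s a) s (X - orbit T b) T)"
    (is "bij_betw ?F ?E ?R")
proof -
  let ?B = "A - orbit s a" and ?p = "least_power s a"
  note peel = bij_betw_peel_orbit[OF s T(2)]
  have OA: "orbit s a \<subseteq> A" by (rule orbit_subset_invariant[OF s(2,3)])
  have aO: "a \<in> orbit s a" by (rule permutation_self_in_orbit[OF s(1)])
  have fin: "finite (orbit s a)" by (rule finite_orbit[OF aO])
  \<comment> \<open>Inside the equivariant maps, the bijective ones are recognised by their image
    under the peeling map; this is what allows the earlier bijection to be restricted.\<close>
  have *: "f \<in> ?E \<longleftrightarrow> ?F f \<in> ?R" if f: "f \<in> equivariant_maps A s X T" for f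
  proof -
    note im = equivariant_image_orbit[OF f s(1) T(1) s(2,3)]
    have fX: "f ` A \<subseteq> X" using f by (auto simp: equivariant_maps_def)
    have r: "restrict f ?B \<in> equivariant_maps ?B s X T"
      using bij_betw_apply[OF peel f] by simp
    show ?thesis
    proof
      assume "f \<in> ?E"
      then have bij: "bij_betw f A X" by (simp add: intertwiners_def)
      then have "bij_betw f ?B (X - orbit T (f a))"
        using bij_betw_subset[OF bij, of ?B] im
        by (metis Diff_subset OA bij_betw_def image_set_diff inj_on_image_set_diff)
      then have "bij_betw (restrict f ?B) ?B (X - orbit T (f a))"
        by (simp add: bij_betw_cong[of ?B "restrict f ?B" f])
      moreover have "restrict f ?B \<in> equivariant_maps ?B s (X - orbit T (f a)) T"
        using r bij_betw_imp_surj_on[OF calculation] by (auto simp: equivariant_maps_def)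
      moreover have "f a \<in> period_set X T ?p"
        using equivariant_bij_least_power[OF f bij_betw_imp_inj_on[OF bij] s(2,3)] s(3) fX
        by (auto simp: period_set_def)
      ultimately show "?F f \<in> ?R" by (simp add: intertwiners_def)
    next
      assume "?F f \<in> ?R"
      then have p: "f a \<in> X" "least_power T (f a) = ?p"
        and "bij_betw (restrict f ?B) ?B (X - orbit T (f a))"
        by (auto simp: intertwiners_def period_set_def)
      then have B: "bij_betw f ?B (X - orbit T (f a))"
        by (simp add: bij_betw_cong[of ?B "restrict f ?B" f])
      \<comment> \<open>Equivariance already makes \<open>f\<close> map the orbit onto the orbit of
        \<open>f a\<close>. The two have equal finite size, so \<open>f\<close> is injective
        there.\<close>
      have "card (f ` orbit s a) = card (orbit s a)"
        using p by (simp add: im card_orbit_eq_least_power s(1) T(1))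
      then have "bij_betw f (orbit s a) (orbit T (f a))"
        using eq_card_imp_inj_on[OF fin, of f] im by (simp add: bij_betw_def)
      from bij_betw_combine[OF this B] have "bij_betw f A X"
        using OA orbit_subset_invariant[OF T(2) p(1)] by (simp add: Un_absorb1)
      then show "f \<in> ?E" using f by (simp add: intertwiners_def)
    qed
  qed
  have sub: "?R \<subseteq> {b \<in> X. (T ^^ ?p) b = b} \<times> equivariant_maps ?B s X T"
  proof -
    have "(T ^^ ?p) b = b" if "b \<in> period_set X T ?p" for b
      using least_power_of_permutation(1)[OF T(1), of b] that by (simp add: period_set_def)
    then show ?thesis by (auto simp: period_set_def intertwiners_def equivariant_maps_def)
  qed
  have sub': "?E \<subseteq> equivariant_maps A s X T" by (auto simp: intertwiners_def)
  show ?thesis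
  proof (rule bij_betw_subset[OF peel sub'])
    show "?F ` ?E = ?R"
    proof (intro equalityI subsetI)
      fix y assume "y \<in> ?R"
      moreover then obtain f where "f \<in> equivariant_maps A s X T" "y = ?F f"
        using sub bij_betw_imp_surj_on[OF peel] by blast
      ultimately show "y \<in> ?F ` ?E" using * by blast
    qed (use * sub' in blast)
  qed
qed

text \<open>If there are m cycles of length i, a point of period i may go to any of the i m points
  of that period, and deleting the two orbits leaves m - 1 such cycles on either side. The choices i
  m, i (m - 1), ..., i multiply to i^m m!.\<close>

lemma card_intertwiners_same_type:
  assumes s: "permutation s" "s ` A \<subseteq> A" "finite A"
    and T: "permutation T" "T ` X \<subseteq> X" "finite X"
    and same: "\<And>i. num_cycles A s i = num_cycles X T i"
    and "finite I" "least_power s ` A \<subseteq> I"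
  shows "card (intertwiners A s X T) = (\<Prod>i\<in>I. i ^ num_cycles A s i * fact (num_cycles A s i))"
  using assms(2,3,5,6,7,9)
proof (induction "card A" arbitrary: A X rule: less_induct)
  case less
  have same': "card (period_set A s i) = card (period_set X T i)" for i
    using card_period_set[OF s(1) less.prems(1,2)] card_period_set[OF T(1) less.prems(3,4)]
      less.prems(5) by simp
  show ?case
  proof (cases "A = {}")
    case True
    \<comment> \<open>Every point of \<open>X\<close> would have some period, and the points of each
      period are as many as in the empty set \<open>A\<close>.\<close>
    have "X = {}"
    proof (rule equals0I)
      fix x assume "x \<in> X"
      then have "x \<in> period_set X T (least_power T x)" by (simp add: period_set_def)
      moreover have "period_set X T (least_power T x) = {}"
        using same'[of "least_power T x"] True less.prems(4) by (simp add: period_set_def)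
      ultimately show False by simp
    qed
    then show ?thesis
      using True
      by (simp add: intertwiners_def equivariant_maps_def num_cycles_def period_set_def
          bij_betw_def cong: conj_cong)
  next
    case False
    then obtain a where a: "a \<in> A" by blast
    let ?B = "A - orbit s a" and ?p = "least_power s a"
    let ?w = "\<lambda>A i. i ^ num_cycles A s i * fact (num_cycles A s i) :: nat"
    have pI: "?p \<in> I" using a less.prems by blast
    have IH: "card (intertwiners ?B s (X - orbit T b) T) = (\<Prod>i\<in>I. ?w ?B i)"
      if b: "b \<in> period_set X T ?p" for b
    proof (rule less.hyps[OF card_Diff_orbit_less[OF s(1) a less.prems(2)]
            Diff_orbit_invariant[OF s(1) less.prems(1)] _
            Diff_orbit_invariant[OF T(1) less.prems(3)]])
      have b': "b \<in> X" "least_power T b = ?p" using b by (auto simp: period_set_def)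
      show "num_cycles ?B s i = num_cycles (X - orbit T b) T i" for i
        using less.prems(5)[of i] b'(2)
          num_cycles_Diff_orbit[OF s(1) less.prems(1) a less.prems(2), of i]
          num_cycles_Diff_orbit[OF T(1) less.prems(3) b'(1) less.prems(4), of i] by simp
    qed (use less.prems in auto)
    have fin: "finite (period_set X T ?p)" using less.prems(4) by (simp add: period_set_def)
    have "card (intertwiners A s X T) =
        card (SIGMA b : period_set X T ?p. intertwiners ?B s (X - orbit T b) T)"
      by (rule bij_betw_same_card[OF bij_betw_peel_orbit_intertwiners[OF s(1) less.prems(1) a
              T(1) less.prems(3)]])
    also have "\<dots> = (\<Sum>b\<in>period_set X T ?p. \<Prod>i\<in>I. ?w ?B i)"
    proof -
      have "finite (intertwiners ?B s (X - orbit T b) T)" for b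
        by (rule finite_subset[OF _ finite_PiE[of ?B "\<lambda>_. X"]])
          (use less.prems in \<open>auto simp: intertwiners_def equivariant_maps_def\<close>)
      then show ?thesis using IH fin by (subst card_SigmaI) auto
    qed
    also have "\<dots> = ?p * num_cycles A s ?p * (\<Prod>i\<in>I. ?w ?B i)"
      using same'[of ?p] card_period_set[OF s(1) less.prems(1,2), of ?p] by simp
    also have "\<dots> = (\<Prod>i\<in>I. ?w A i)"
    proof -
      have n: "num_cycles A s i = num_cycles ?B s i + (if i = ?p then 1 else 0)" for i
        by (rule num_cycles_Diff_orbit[OF s(1) less.prems(1) a less.prems(2)])
      have "(\<Prod>i\<in>I. ?w A i) = ?w A ?p * (\<Prod>i\<in>I - {?p}. ?w A i)"
        by (rule prod.remove[OF assms(8) pI])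
      also have "(\<Prod>i\<in>I - {?p}. ?w A i) = (\<Prod>i\<in>I - {?p}. ?w ?B i)"
        using n by (intro prod.cong) auto
      also have "?w A ?p = ?p * num_cycles A s ?p * ?w ?B ?p"
        using n[of ?p] by (simp add: algebra_simps)
      finally show ?thesis by (simp add: prod.remove[OF assms(8) pI, of "?w ?B"])
    qed
    finally show ?thesis .
  qed
qed

text \<open>Periods are preserved, so an intertwiner would match the points of period i on the two
  sides.\<close>

lemma intertwiners_different_type:
  assumes "s ` A \<subseteq> A" "num_cycles A s i \<noteq> num_cycles X T i"
  shows "intertwiners A s X T = {}"
proof (rule equals0I)
  fix f assume "f \<in> intertwiners A s X T"
  then have f: "f \<in> equivariant_maps A s X T" and bij: "bij_betw f A X"
    by (auto simp: intertwiners_def)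
  have p: "least_power T (f a) = least_power s a" if "a \<in> A" for a
    by (rule equivariant_bij_least_power[OF f bij_betw_imp_inj_on[OF bij] assms(1) that])
  have "f ` period_set A s i = period_set X T i"
    using p bij_betw_imp_surj_on[OF bij] by (auto simp: period_set_def)
  then have "bij_betw f (period_set A s i) (period_set X T i)"
    by (intro bij_betw_subset[OF bij]) (auto simp: period_set_def)
  from bij_betw_same_card[OF this] show False using assms(2) by (simp add: num_cycles_def)
qed

lemma sum_card_swap:
  assumes "finite A" "finite B"
  shows "(\<Sum>a\<in>A. card {b \<in> B. P a b}) = (\<Sum>b\<in>B. card {a \<in> A. P a b})"
proof -
  have "(\<Sum>a\<in>A. card {b \<in> B. P a b}) = (\<Sum>a\<in>A. \<Sum>b | b \<in> B \<and> P a b. 1)" by simp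
  also have "\<dots> = (\<Sum>b\<in>B. \<Sum>a | a \<in> A \<and> P a b. 1)" by (rule sum.swap_restrict[OF assms])
  finally show ?thesis by simp
qed

section \<open>Partitions\<close>

declare One_nat_def [simp del]

text \<open>Removes the range {1..n}, so that partitions of different numbers can be compared when a
  part is added. That parts are at most n is automatic, as a part i contributes at least i to the
  sum.\<close>

lemma partitions_iff:
  "p \<in> partitions n \<longleftrightarrow>
    0 \<notin> Poly_Mapping.keys p \<and> (\<Sum>i\<in>Poly_Mapping.keys p. i * Poly_Mapping.lookup p i) = n"
proof -
  have eq: "(\<Sum>i=1..n. i * Poly_Mapping.lookup p i) =
      (\<Sum>i\<in>Poly_Mapping.keys p. i * Poly_Mapping.lookup p i)" if "Poly_Mapping.keys p \<subseteq> {1..n}"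
    using that by (intro sum.mono_neutral_right) (auto simp: in_keys_iff)
  have le: "i \<le> (\<Sum>i\<in>Poly_Mapping.keys p. i * Poly_Mapping.lookup p i)"
    if "i \<in> Poly_Mapping.keys p" for i
  proof -
    have "i \<le> i * Poly_Mapping.lookup p i" using that by (simp add: in_keys_iff)
    also have "\<dots> \<le> (\<Sum>i\<in>Poly_Mapping.keys p. i * Poly_Mapping.lookup p i)"
      by (rule member_le_sum[OF that]) auto
    finally show ?thesis .
  qed
  show ?thesis
  proof
    assume "p \<in> partitions n"
    then show "0 \<notin> Poly_Mapping.keys p \<and>
        (\<Sum>i\<in>Poly_Mapping.keys p. i * Poly_Mapping.lookup p i) = n"
      using eq by (auto simp: partitions_def)
  next
    assume a: "0 \<notin> Poly_Mapping.keys p \<and>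
        (\<Sum>i\<in>Poly_Mapping.keys p. i * Poly_Mapping.lookup p i) = n"
    then have "i \<in> {1..n}" if "i \<in> Poly_Mapping.keys p" for i
      using le[OF that] that by (cases i) auto
    then have "Poly_Mapping.keys p \<subseteq> {1..n}" by blast
    then show "p \<in> partitions n" using eq a by (simp add: partitions_def)
  qed
qed

lemma partitions_keys:
  "p \<in> partitions n \<Longrightarrow> Poly_Mapping.keys p \<subseteq> {1..n}"
  by (simp add: partitions_def)

lemma partitions_lookup_eq_0:
  "p \<in> partitions n \<Longrightarrow> i \<notin> {1..n} \<Longrightarrow> Poly_Mapping.lookup p i = 0"
  using partitions_keys by (metis in_keys_iff subsetD)

lemma weight_superset:
  fixes p :: "nat \<Rightarrow>\<^sub>0 nat"
  assumes "finite I" "Poly_Mapping.keys p \<subseteq> I"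
  shows "(\<Sum>i\<in>Poly_Mapping.keys p. i * Poly_Mapping.lookup p i) =
    (\<Sum>i\<in>I. i * Poly_Mapping.lookup p i)"
  using assms by (intro sum.mono_neutral_left) (auto simp: in_keys_iff)

lemma partitions_add_single:
  assumes "1 \<le> i" "i \<le> n"
  shows "p + Poly_Mapping.single i 1 \<in> partitions n \<longleftrightarrow> p \<in> partitions (n - i)"
proof -
  let ?q = "p + Poly_Mapping.single i 1"
  let ?I = "insert i (Poly_Mapping.keys p)"
  have q: "Poly_Mapping.keys ?q = ?I"
    by (auto simp: in_keys_iff lookup_add lookup_single when_def split: if_splits)
  have "(\<Sum>j\<in>?I. j * Poly_Mapping.lookup ?q j) =
      (\<Sum>j\<in>?I. j * Poly_Mapping.lookup p j) + (\<Sum>j\<in>?I. if j = i then i else 0)"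
    unfolding sum.distrib[symmetric]
    by (intro sum.cong) (auto simp: lookup_add lookup_single algebra_simps)
  also have "\<dots> = (\<Sum>j\<in>Poly_Mapping.keys p. j * Poly_Mapping.lookup p j) + i"
    by (subst weight_superset[of ?I p]) (auto simp: sum.delta)
  finally show ?thesis
    using assms by (auto simp: partitions_iff q)
qed

lemma finite_partitions: "finite (partitions n)"
proof (rule inj_on_finite)
  show "inj_on (\<lambda>p. restrict (Poly_Mapping.lookup p) {1..n}) (partitions n)"
  proof (rule inj_onI)
    fix p q assume pq: "p \<in> partitions n" "q \<in> partitions n"
      and eq: "restrict (Poly_Mapping.lookup p) {1..n} = restrict (Poly_Mapping.lookup q) {1..n}"
    show "p = q"
    proof (rule poly_mapping_eqI)
      fix i show "Poly_Mapping.lookup p i = Poly_Mapping.lookup q i"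
        using fun_cong[OF eq, of i] partitions_lookup_eq_0[OF pq(1), of i]
          partitions_lookup_eq_0[OF pq(2), of i] by (cases "i \<in> {1..n}") auto
    qed
  qed
  show "(\<lambda>p. restrict (Poly_Mapping.lookup p) {1..n}) ` partitions n \<subseteq> {1..n} \<rightarrow>\<^sub>E {..n}"
  proof (clarsimp simp: PiE_iff)
    fix p i assume p: "p \<in> partitions n" and i: "1 \<le> i" "i \<le> n"
    have "Poly_Mapping.lookup p i \<le> i * Poly_Mapping.lookup p i" using i by simp
    also have "\<dots> \<le> (\<Sum>i=1..n. i * Poly_Mapping.lookup p i)"
      by (rule member_le_sum) (use i in auto)
    also have "\<dots> = n" using p by (simp add: partitions_def)
    finally show "Poly_Mapping.lookup p i \<le> n" .
  qed
qed (auto intro: finite_PiE)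

lemma partitions_0: "partitions 0 = {0}"
  by (auto simp: partitions_def)

text \<open>A partition of n with a distinguished part size i corresponds to a partition of n - i,
  by deleting one copy of i. Both the total of the 1/Sym(p) and the coefficients of
  \<open>Z1\<close> rest on this reindexing.\<close>

lemma sum_partitions_remove_part:
  fixes g :: "(nat \<Rightarrow>\<^sub>0 nat) \<Rightarrow> nat \<Rightarrow> 'b::comm_monoid_add"
  shows "(\<Sum>p\<in>partitions n. \<Sum>i\<in>Poly_Mapping.keys p. g p i) =
    (\<Sum>i=1..n. \<Sum>p\<in>partitions (n - i). g (p + Poly_Mapping.single i 1) i)"
proof -
  have minus: "p - Poly_Mapping.single i 1 + Poly_Mapping.single i 1 = p"
    if "i \<in> Poly_Mapping.keys p" for p :: "nat \<Rightarrow>\<^sub>0 nat" and i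
    using that by (intro poly_mapping_eqI)
      (auto simp: lookup_add lookup_minus lookup_single when_def in_keys_iff)
  have "(\<Sum>p\<in>partitions n. \<Sum>i\<in>Poly_Mapping.keys p. g p i) =
      (\<Sum>(p, i)\<in>(SIGMA p:partitions n. Poly_Mapping.keys p). g p i)"
    by (rule sum.Sigma) (auto simp: finite_partitions)
  also have "\<dots> = (\<Sum>(i, p)\<in>(SIGMA i:{1..n}. partitions (n - i)).
      g (p + Poly_Mapping.single i 1) i)"
  proof (rule sum.reindex_bij_witness[
        of _ "\<lambda>(i, p). (p + Poly_Mapping.single i 1, i)" "\<lambda>(p, i). (i, p - Poly_Mapping.single i 1)"])
    fix a assume "a \<in> (SIGMA p:partitions n. Poly_Mapping.keys p)"
    then obtain p i where a: "a = (p, i)" and p: "p \<in> partitions n" "i \<in> Poly_Mapping.keys p"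
      by blast
    have i: "1 \<le> i" "i \<le> n" using p partitions_keys by force+
    have "p - Poly_Mapping.single i 1 \<in> partitions (n - i)"
      unfolding partitions_add_single[OF i, symmetric] minus[OF p(2)] by (rule p(1))
    then show "(case a of (p, i) \<Rightarrow> (i, p - Poly_Mapping.single i 1))
        \<in> (SIGMA i:{1..n}. partitions (n - i))"
      using a i by simp
    show "(case case a of (p, i) \<Rightarrow> (i, p - Poly_Mapping.single i 1) of
        (i, p) \<Rightarrow> (p + Poly_Mapping.single i 1, i)) = a"
      using a minus[OF p(2)] by simp
    show "(case case a of (p, i) \<Rightarrow> (i, p - Poly_Mapping.single i 1) of
        (i, p) \<Rightarrow> g (p + Poly_Mapping.single i 1) i) = (case a of (p, i) \<Rightarrow> g p i)"
      using a minus[OF p(2)] by simp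
  next
    fix b assume "b \<in> (SIGMA i:{1..n}. partitions (n - i))"
    then obtain i p where b: "b = (i, p)" and i: "1 \<le> i" "i \<le> n" and p: "p \<in> partitions (n - i)"
      by auto
    show "(case b of (i, p) \<Rightarrow> (p + Poly_Mapping.single i 1, i))
        \<in> (SIGMA p:partitions n. Poly_Mapping.keys p)"
      using b p partitions_add_single[OF i, of p]
      by (auto simp: in_keys_iff lookup_add)
    show "(case case b of (i, p) \<Rightarrow> (p + Poly_Mapping.single i 1, i) of
        (p, i) \<Rightarrow> (i, p - Poly_Mapping.single i 1)) = b"
      using b by simp
  qed
  also have "\<dots> = (\<Sum>i=1..n. \<Sum>p\<in>partitions (n - i). g (p + Poly_Mapping.single i 1) i)"
    by (rule sum.Sigma[symmetric]) (auto simp: finite_partitions)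
  finally show ?thesis .
qed

text \<open>Multiplicity 0 contributes the factor 1. The freedom in the range serves to compare
  \<open>Sym (n - i)\<close> with \<open>Sym n\<close>, and later to let a range of odd numbers
  overshoot n.\<close>

lemma Sym_superset:
  assumes "p \<in> partitions n" "finite I" "Poly_Mapping.keys p \<subseteq> I"
  shows "Sym n p = (\<Prod>i\<in>I. of_nat i ^ Poly_Mapping.lookup p i * fact (Poly_Mapping.lookup p i))"
proof -
  have "Sym n p = (\<Prod>i\<in>Poly_Mapping.keys p.
      of_nat i ^ Poly_Mapping.lookup p i * fact (Poly_Mapping.lookup p i))"
    unfolding Sym_def using partitions_keys[OF assms(1)]
    by (intro prod.mono_neutral_right) (auto simp: in_keys_iff)
  also have "\<dots> = (\<Prod>i\<in>I. of_nat i ^ Poly_Mapping.lookup p i * fact (Poly_Mapping.lookup p i))"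
    using assms by (intro prod.mono_neutral_left) (auto simp: in_keys_iff)
  finally show ?thesis .
qed

lemma Sym_pos: "Sym n p > 0"
  unfolding Sym_def by (intro prod_pos) auto

lemma Sym_add_single:
  assumes "1 \<le> i" "i \<le> n" "p \<in> partitions (n - i)"
  shows "Sym n (p + Poly_Mapping.single i 1) =
    of_nat (i * (Poly_Mapping.lookup p i + 1)) * Sym (n - i) p"
proof -
  let ?q = "p + Poly_Mapping.single i 1"
  let ?w = "\<lambda>p i. of_nat i ^ Poly_Mapping.lookup p i * fact (Poly_Mapping.lookup p i) :: rat"
  have i: "i \<in> {1..n}" using assms by simp
  have "Sym (n - i) p = (\<Prod>j=1..n. ?w p j)"
    by (rule Sym_superset[OF assms(3)]) (use partitions_keys[OF assms(3)] in force)+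
  also have "\<dots> = ?w p i * (\<Prod>j\<in>{1..n} - {i}. ?w p j)"
    by (rule prod.remove[OF _ i]) simp
  finally have p: "Sym (n - i) p = \<dots>" .
  have "Sym n ?q = ?w ?q i * (\<Prod>j\<in>{1..n} - {i}. ?w ?q j)"
    unfolding Sym_def by (rule prod.remove[OF _ i]) simp
  also have "(\<Prod>j\<in>{1..n} - {i}. ?w ?q j) = (\<Prod>j\<in>{1..n} - {i}. ?w p j)"
    by (intro prod.cong) (auto simp: lookup_add lookup_single when_def)
  also have "?w ?q i = of_nat (i * (Poly_Mapping.lookup p i + 1)) * ?w p i"
  proof -
    have "Poly_Mapping.lookup ?q i = Suc (Poly_Mapping.lookup p i)" by (simp add: lookup_add)
    then show ?thesis by (simp add: algebra_simps)
  qed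
  finally show ?thesis by (simp add: p)
qed

lemma sum_keys_over_Sym:
  assumes "p \<in> partitions n"
  shows "of_nat n / Sym n p =
    (\<Sum>i\<in>Poly_Mapping.keys p. of_nat (i * Poly_Mapping.lookup p i) / Sym n p)"
  using assms
  by (simp add: partitions_iff sum_divide_distrib[symmetric] of_nat_sum[symmetric]
      del: of_nat_sum of_nat_mult)

text \<open>Comparing this recursion with \<open>n c\<^sub>n = \<Sum>\<^sub>i c\<^sub>n\<^sub>-\<^sub>i\<close> for the constant sequence 1
  shows that the class sizes \<open>n!/Sym p\<close> add up to \<open>n!\<close>.\<close>

lemma sum_inverse_Sym: "(\<Sum>p\<in>partitions n. 1 / Sym n p) = 1"
proof (induction n rule: less_induct)
  case (less n)
  show ?case
  proof (cases "n = 0")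
    case True
    then show ?thesis by (simp add: partitions_0 Sym_def)
  next
    case False
    have "of_nat n * (\<Sum>p\<in>partitions n. 1 / Sym n p) =
        (\<Sum>p\<in>partitions n. \<Sum>i\<in>Poly_Mapping.keys p. of_nat (i * Poly_Mapping.lookup p i) / Sym n p)"
      unfolding sum_distrib_left by (intro sum.cong) (simp_all add: sum_keys_over_Sym)
    also have "\<dots> = (\<Sum>i=1..n. \<Sum>p\<in>partitions (n - i). 1 / Sym (n - i) p)"
      unfolding sum_partitions_remove_part
    proof (intro sum.cong refl)
      fix i p assume "i \<in> {1..n}" "p \<in> partitions (n - i)"
      then show "of_nat (i * Poly_Mapping.lookup (p + Poly_Mapping.single i 1) i) /
          Sym n (p + Poly_Mapping.single i 1) = 1 / Sym (n - i) p"
        by (subst Sym_add_single) (auto simp: lookup_add simp del: of_nat_mult of_nat_add)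
    qed
    also have "\<dots> = (\<Sum>i=1..n. 1)"
      by (intro sum.cong refl less.IH) auto
    finally show ?thesis using False by simp
  qed
qed

section \<open>Cycle types\<close>

lemma finite_perms: "finite (perms n)"
  by (simp add: perms_def finite_permutations)

lemma card_perms: "card (perms n) = fact n"
  unfolding perms_def by (rule card_permutations) simp_all

lemma permutation_perms: "s \<in> perms n \<Longrightarrow> permutation s"
  using permutation_permutes by (auto simp: perms_def)

lemma perms_comp: "s \<in> perms n \<Longrightarrow> t \<in> perms n \<Longrightarrow> s \<circ> t \<in> perms n"
  by (simp add: perms_def permutes_compose)

lemma perms_inv: "s \<in> perms n \<Longrightarrow> inv s \<in> perms n"
  by (simp add: perms_def permutes_inv)

lemma perms_funpow: "s \<in> perms n \<Longrightarrow> s ^^ k \<in> perms n"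
  by (simp add: perms_def permutes_funpow)

lemma perms_inv_comp:
  assumes "s \<in> perms n"
  shows "s \<circ> inv s = id" "inv s \<circ> s = id"
  using assms permutes_inv_o by (auto simp: perms_def)

lemma perms_cancel:
  assumes "s \<in> perms n"
  shows "s \<circ> (inv s \<circ> f) = f" "inv s \<circ> (s \<circ> f) = f"
  using perms_inv_comp[OF assms] by (simp_all add: o_assoc)

lemma perms_image: "s \<in> perms n \<Longrightarrow> s ` {1..n} \<subseteq> {1..n}"
  by (simp add: perms_def permutes_image)

text \<open>\<open>Abs_poly_mapping\<close> gives back \<open>num_cycles\<close> only under finite
  support; membership in \<open>perms n\<close> ensures it, see
  \<open>lookup_cycle_type\<close>.\<close>

definition cycle_type :: "nat \<Rightarrow> (nat \<Rightarrow> nat) \<Rightarrow> (nat \<Rightarrow>\<^sub>0 nat)" where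
  "cycle_type n s = Abs_poly_mapping (num_cycles {1..n} s)"

lemma least_power_perms:
  assumes "s \<in> perms n" "a \<in> {1..n}"
  shows "least_power s a \<in> {1..n}"
proof -
  have "least_power s a = card (orbit s a)"
    using card_orbit_eq_least_power[OF permutation_perms[OF assms(1)]] by simp
  also have "\<dots> \<le> card {1..n}"
    by (intro card_mono orbit_subset_invariant perms_image assms) simp
  finally show ?thesis
    using least_power_of_permutation(2)[OF permutation_perms[OF assms(1)], of a] by simp
qed

lemma num_cycles_eq_0:
  assumes "s \<in> perms n" "i \<notin> {1..n}"
  shows "num_cycles {1..n} s i = 0"
proof -
  have "period_set {1..n} s i = {}"
    using least_power_perms[OF assms(1)] assms(2) by (auto simp: period_set_def)
  then show ?thesis by (simp add: num_cycles_def)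
qed

lemma lookup_cycle_type:
  assumes "s \<in> perms n"
  shows "Poly_Mapping.lookup (cycle_type n s) i = num_cycles {1..n} s i"
proof -
  have "{i. num_cycles {1..n} s i \<noteq> 0} \<subseteq> {1..n}"
    by (intro subsetI, rule ccontr) (simp add: num_cycles_eq_0[OF assms] del: atLeastAtMost_iff)
  from finite_subset[OF this] have "finite {i. num_cycles {1..n} s i \<noteq> 0}" by simp
  then show ?thesis by (simp add: cycle_type_def)
qed

lemma card_period_set_perms:
  assumes "s \<in> perms n"
  shows "card (period_set {1..n} s i) = i * Poly_Mapping.lookup (cycle_type n s) i"
  unfolding lookup_cycle_type[OF assms]
  by (rule card_period_set[OF permutation_perms[OF assms] perms_image[OF assms]]) simp

lemma cycle_type_in_partitions:
  assumes "s \<in> perms n"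
  shows "cycle_type n s \<in> partitions n"
proof -
  have "(\<Sum>i=1..n. i * Poly_Mapping.lookup (cycle_type n s) i) =
      (\<Sum>i=1..n. card (period_set {1..n} s i))"
    by (simp add: card_period_set_perms[OF assms])
  also have "\<dots> = card (\<Union>i\<in>{1..n}. period_set {1..n} s i)"
    by (subst card_UN_disjoint) (auto simp: period_set_def)
  also have "(\<Union>i\<in>{1..n}. period_set {1..n} s i) = {1..n}"
  proof (intro equalityI subsetI)
    fix x assume "x \<in> {1..n}"
    then show "x \<in> (\<Union>i\<in>{1..n}. period_set {1..n} s i)"
      using least_power_perms[OF assms, of x] by (auto simp: period_set_def)
  qed (auto simp: period_set_def)
  finally have "(\<Sum>i=1..n. i * Poly_Mapping.lookup (cycle_type n s) i) = n" by simp
  moreover have "Poly_Mapping.keys (cycle_type n s) \<subseteq> {1..n}"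
    by (intro subsetI, rule ccontr)
      (simp add: in_keys_iff lookup_cycle_type[OF assms] num_cycles_eq_0[OF assms]
        del: atLeastAtMost_iff)
  ultimately show ?thesis by (simp add: partitions_def)
qed

text \<open>Off {1..n} an element of \<open>perms n\<close> is the identity, while an intertwiner is
  \<open>undefined\<close>. Extension by the identity inverts the restriction, and t \<circ> r = s
  \<circ> t holds off {1..n} because r and s fix those points too.\<close>

lemma bij_betw_intertwiners_perms:
  assumes r: "r \<in> perms n" and s: "s \<in> perms n"
  shows "bij_betw (\<lambda>t. restrict t {1..n}) {t \<in> perms n. t \<circ> r = s \<circ> t}
    (intertwiners {1..n} r {1..n} s)"
proof (rule bij_betw_imageI)
  let ?A = "{1..n}"
  show "inj_on (\<lambda>t. restrict t ?A) {t \<in> perms n. t \<circ> r = s \<circ> t}"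
  proof (rule inj_onI)
    fix t u assume t: "t \<in> {t \<in> perms n. t \<circ> r = s \<circ> t}" and u: "u \<in> {t \<in> perms n. t \<circ> r = s \<circ> t}"
      and eq: "restrict t ?A = restrict u ?A"
    show "t = u"
    proof
      fix x show "t x = u x"
        using fun_cong[OF eq, of x] t u
        by (cases "x \<in> ?A") (auto simp: perms_def permutes_def)
    qed
  qed
  show "(\<lambda>t. restrict t ?A) ` {t \<in> perms n. t \<circ> r = s \<circ> t} = intertwiners ?A r ?A s"
  proof (intro equalityI subsetI)
    fix f assume "f \<in> (\<lambda>t. restrict t ?A) ` {t \<in> perms n. t \<circ> r = s \<circ> t}"
    then obtain t where t: "t \<in> perms n" "t \<circ> r = s \<circ> t" and f: "f = restrict t ?A" by blast
    have "bij_betw f ?A ?A"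
      using t(1) unfolding f by (subst bij_betw_cong[of ?A _ t]) (simp_all add: perms_def permutes_imp_bij)
    moreover have "f (r a) = s (f a)" if "a \<in> ?A" for a
      using perms_image[OF r] that fun_cong[OF t(2), of a] by (auto simp: f image_subset_iff)
    ultimately show "f \<in> intertwiners ?A r ?A s"
      using bij_betw_imp_surj_on[of f ?A ?A]
      by (auto simp: intertwiners_def equivariant_maps_def f)
  next
    fix f assume "f \<in> intertwiners ?A r ?A s"
    then have f: "f \<in> ?A \<rightarrow>\<^sub>E ?A" "\<And>a. a \<in> ?A \<Longrightarrow> f (r a) = s (f a)" and bij: "bij_betw f ?A ?A"
      by (auto simp: intertwiners_def equivariant_maps_def)
    define t where "t x = (if x \<in> ?A then f x else x)" for x
    have "bij_betw t ?A ?A"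
      using bij by (subst bij_betw_cong[of ?A t f]) (simp_all add: t_def)
    then have t: "t \<in> perms n"
      unfolding perms_def mem_Collect_eq by (rule bij_imp_permutes) (auto simp: t_def)
    have "t \<circ> r = s \<circ> t"
    proof
      fix x show "(t \<circ> r) x = (s \<circ> t) x"
        using r s f(2)[of x] perms_image[OF r]
        by (cases "x \<in> ?A") (auto simp: t_def perms_def permutes_def image_subset_iff)
    qed
    moreover have "f = restrict t ?A"
      using f(1) by (intro ext) (auto simp: t_def restrict_def PiE_def extensional_def)
    ultimately show "f \<in> (\<lambda>t. restrict t ?A) ` {t \<in> perms n. t \<circ> r = s \<circ> t}" using t by blast
  qed
qed

text \<open>The condition on t says that t conjugates r to s. For r = s the solutions form the
  centralizer, so \<open>Sym\<close> is the order of the centralizer.\<close>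

lemma card_intertwining_perms:
  assumes r: "r \<in> perms n" and s: "s \<in> perms n"
  shows "of_nat (card {t \<in> perms n. t \<circ> r = s \<circ> t}) =
    (if cycle_type n r = cycle_type n s then Sym n (cycle_type n r) else 0)"
proof -
  have "card {t \<in> perms n. t \<circ> r = s \<circ> t} = card (intertwiners {1..n} r {1..n} s)"
    by (rule bij_betw_same_card[OF bij_betw_intertwiners_perms[OF assms]])
  moreover have "of_nat \<dots> = Sym n (cycle_type n r)" if "cycle_type n r = cycle_type n s"
  proof -
    have "num_cycles {1..n} r i = num_cycles {1..n} s i" for i
      using that lookup_cycle_type[OF r] lookup_cycle_type[OF s] by metis
    then have "card (intertwiners {1..n} r {1..n} s) =
        (\<Prod>i=1..n. i ^ num_cycles {1..n} r i * fact (num_cycles {1..n} r i))"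
      using least_power_perms[OF r]
      by (intro card_intertwiners_same_type[OF permutation_perms[OF r] perms_image[OF r] _
            permutation_perms[OF s] perms_image[OF s]]) auto
    then show ?thesis by (simp add: Sym_def lookup_cycle_type[OF r])
  qed
  moreover have "card (intertwiners {1..n} r {1..n} s) = 0" if "cycle_type n r \<noteq> cycle_type n s"
  proof -
    have "\<exists>i. num_cycles {1..n} r i \<noteq> num_cycles {1..n} s i"
    proof (rule ccontr)
      assume "\<not> ?thesis"
      then have "cycle_type n r = cycle_type n s"
        by (intro poly_mapping_eqI) (simp add: lookup_cycle_type r s)
      then show False using that by simp
    qed
    then obtain i where "num_cycles {1..n} r i \<noteq> num_cycles {1..n} s i" by blast
    from intertwiners_different_type[OF perms_image[OF r] this] show ?thesis by simp
  qed
  ultimately show ?thesis by simp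
qed

lemma card_conjugating:
  assumes "r \<in> perms n" "t \<in> perms n"
  shows "card {s \<in> perms n. t \<circ> r = s \<circ> t} = 1"
proof -
  have "{s \<in> perms n. t \<circ> r = s \<circ> t} = {t \<circ> r \<circ> inv t}"
  proof (intro equalityI subsetI)
    fix s assume "s \<in> {s \<in> perms n. t \<circ> r = s \<circ> t}"
    then have "t \<circ> r \<circ> inv t = s \<circ> t \<circ> inv t" by simp
    then show "s \<in> {t \<circ> r \<circ> inv t}" using perms_inv_comp[OF assms(2)] by (simp add: comp_assoc)
  qed (use assms perms_inv_comp[OF assms(2)] in \<open>auto simp: perms_comp perms_inv comp_assoc\<close>)
  then show ?thesis by simp
qed

text \<open>Count the pairs (s, t) with t \<circ> r = s \<circ> t for a fixed r of type p. Each t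
  admits exactly one s, and each s of type p admits Sym(p) of the t, so a class that is not empty
  attains the bound. An inequality is stated in order to include the empty case.\<close>

lemma card_cycle_type_le:
  assumes "p \<in> partitions n"
  shows "of_nat (card {s \<in> perms n. cycle_type n s = p}) \<le> fact n / Sym n p"
proof (cases "{s \<in> perms n. cycle_type n s = p} = {}")
  case True
  show ?thesis unfolding True using Sym_pos[of n p] by (simp add: less_imp_le)
next
  case False
  then obtain r where r: "r \<in> perms n" "cycle_type n r = p" by blast
  have "of_nat (card {s \<in> perms n. cycle_type n s = p}) * Sym n p =
      (\<Sum>s\<in>perms n. if cycle_type n r = cycle_type n s then Sym n (cycle_type n r) else 0)"
    using r by (simp add: sum.If_cases finite_perms Int_def eq_commute)
  also have "\<dots> = (\<Sum>s\<in>perms n. of_nat (card {t \<in> perms n. t \<circ> r = s \<circ> t}))"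
    by (intro sum.cong refl) (simp add: card_intertwining_perms[OF r(1)])
  also have "\<dots> = of_nat (\<Sum>t\<in>perms n. card {s \<in> perms n. t \<circ> r = s \<circ> t})"
    unfolding of_nat_sum[symmetric] by (subst sum_card_swap) (simp_all add: finite_perms)
  also have "(\<Sum>t\<in>perms n. card {s \<in> perms n. t \<circ> r = s \<circ> t}) = (\<Sum>t\<in>perms n. 1)"
    by (intro sum.cong refl card_conjugating r)
  finally show ?thesis using Sym_pos[of n p] by (simp add: card_perms field_simps)
qed

text \<open>The class sizes add up to n!, and so do the upper bounds n!/Sym(p); hence every bound is
  attained.\<close>

lemma card_cycle_type:
  assumes "p \<in> partitions n"
  shows "of_nat (card {s \<in> perms n. cycle_type n s = p}) = fact n / Sym n p"
proof -
  have "(\<Sum>p\<in>partitions n. of_nat (card {s \<in> perms n. cycle_type n s = p})) =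
      of_nat (card (\<Union>p\<in>partitions n. {s \<in> perms n. cycle_type n s = p}))"
    by (subst card_UN_disjoint) (auto simp: finite_partitions finite_perms)
  also have "(\<Union>p\<in>partitions n. {s \<in> perms n. cycle_type n s = p}) = perms n"
    using cycle_type_in_partitions by blast
  also have "of_nat (card (perms n)) = fact n * (\<Sum>p\<in>partitions n. 1 / Sym n p)"
    by (simp add: card_perms sum_inverse_Sym)
  also have "\<dots> = (\<Sum>p\<in>partitions n. fact n / Sym n p)"
    by (simp add: sum_distrib_left)
  finally show ?thesis
    by (rule sum_mono_inv[OF _ card_cycle_type_le assms finite_partitions])
qed

text \<open>The bridge from sums over a symmetric group to sums over partitions. It is applied both
  to \<open>perms n\<close> and to the recolourings in \<open>perms 4\<close>.\<close>

lemma sum_perms_cycle_type: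
  fixes h :: "(nat \<Rightarrow>\<^sub>0 nat) \<Rightarrow> rat"
  shows "(\<Sum>s\<in>perms n. h (cycle_type n s)) = fact n * (\<Sum>p\<in>partitions n. h p / Sym n p)"
proof -
  have "(\<Sum>s\<in>perms n. h (cycle_type n s)) =
      (\<Sum>p\<in>partitions n. \<Sum>s | s \<in> perms n \<and> cycle_type n s = p. h (cycle_type n s))"
    using cycle_type_in_partitions
    by (intro sum.group[symmetric]) (auto simp: finite_perms finite_partitions)
  also have "\<dots> = (\<Sum>p\<in>partitions n. fact n / Sym n p * h p)"
    by (intro sum.cong refl) (simp add: card_cycle_type)
  finally show ?thesis by (simp add: sum_distrib_left)
qed

section \<open>Powers of permutations\<close>

text \<open>The effect of a k-th power on cycle types, see \<open>cycle_type_funpow\<close>. Cycles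
  of different lengths may break into cycles of the same length, so the contributions are
  added.\<close>

definition power_type :: "nat \<Rightarrow> (nat \<Rightarrow>\<^sub>0 nat) \<Rightarrow> (nat \<Rightarrow>\<^sub>0 nat)" where
  "power_type k p =
    (\<Sum>i\<in>Poly_Mapping.keys p. Poly_Mapping.single (i div gcd i k) (gcd i k * Poly_Mapping.lookup p i))"

lemma lookup_power_type:
  assumes "finite I" "Poly_Mapping.keys p \<subseteq> I"
  shows "Poly_Mapping.lookup (power_type k p) j =
    (\<Sum>i\<in>I. if i div gcd i k = j then gcd i k * Poly_Mapping.lookup p i else 0)"
proof -
  have "Poly_Mapping.lookup (power_type k p) j = (\<Sum>i\<in>Poly_Mapping.keys p.
      if i div gcd i k = j then gcd i k * Poly_Mapping.lookup p i else 0)"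
    by (simp add: power_type_def lookup_sum lookup_single when_def)
  also have "\<dots> = (\<Sum>i\<in>I. if i div gcd i k = j then gcd i k * Poly_Mapping.lookup p i else 0)"
    using assms by (intro sum.mono_neutral_left) (auto simp: in_keys_iff)
  finally show ?thesis .
qed

text \<open>With p the period of x and g = gcd(p, k): (s^k)^m fixes x iff p divides k m, iff p/g
  divides m, because p/g and k/g are coprime. Numbers with the same multiples are equal.\<close>

lemma least_power_funpow:
  assumes "permutation s" "k > 0"
  shows "least_power (s ^^ k) x = least_power s x div gcd (least_power s x) k"
proof -
  let ?p = "least_power s x"
  have perm: "permutation (s ^^ k)"
    using assms(1) by (induction k) (simp_all add: permutation_compose)
  have "least_power (s ^^ k) x dvd m \<longleftrightarrow> ?p div gcd ?p k dvd m" for m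
  proof -
    have "least_power (s ^^ k) x dvd m \<longleftrightarrow> ?p dvd k * m"
      by (simp add: least_power_dvd[OF perm] least_power_dvd[OF assms(1)] funpow_mult mult.commute)
    also have "\<dots> \<longleftrightarrow> ?p div gcd ?p k dvd m"
    proof -
      define g a b where "g = gcd ?p k" and "a = ?p div g" and "b = k div g"
      have g: "g > 0" using assms(2) by (simp add: g_def)
      have p: "?p = a * g" and k: "k = b * g" by (simp_all add: a_def b_def g_def)
      have "coprime a b"
        using div_gcd_coprime[of ?p k] assms(2) by (simp add: a_def b_def g_def)
      have "?p dvd k * m \<longleftrightarrow> a * g dvd (b * m) * g"
        unfolding p by (subst k) (simp add: ac_simps)
      also have "\<dots> \<longleftrightarrow> a dvd b * m" using g by simp
      also have "\<dots> \<longleftrightarrow> a dvd m" by (rule coprime_dvd_mult_right_iff[OF \<open>coprime a b\<close>])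
      also have "a = ?p div gcd ?p k" by (simp add: a_def g_def)
      finally show ?thesis .
    qed
    finally show ?thesis .
  qed
  then show ?thesis by (metis dvd_antisym dvd_refl)
qed

text \<open>Points are counted instead of cycles: the points of period j under s^k are those whose
  period i under s satisfies i/gcd(i,k) = j. There are i p_i of them for each such i, and division
  by j turns this into gcd(i,k) p_i.\<close>

lemma cycle_type_funpow:
  assumes "s \<in> perms n" "k > 0"
  shows "cycle_type n (s ^^ k) = power_type k (cycle_type n s)"
proof (rule poly_mapping_eqI)
  fix j
  let ?p = "cycle_type n s" and ?q = "cycle_type n (s ^^ k)"
  note part = cycle_type_in_partitions[OF assms(1)]
  note lk = lookup_power_type[OF _ partitions_keys[OF part], of k j]
  have sk: "s ^^ k \<in> perms n" by (rule perms_funpow[OF assms(1)])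
  show "Poly_Mapping.lookup ?q j = Poly_Mapping.lookup (power_type k ?p) j"
  \<comment> \<open>The comparison of point counts carries a factor j and says nothing for j = 0.
    There both sides vanish, as i div gcd(i,k) is positive for positive i.\<close>
  proof (cases "j = 0")
    case True
    have "i div gcd i k \<noteq> 0" if "i \<in> {1..n}" for i
    proof -
      have "gcd i k \<le> i" "gcd i k > 0" using that by (auto intro: gcd_le1_nat)
      then show ?thesis by (simp add: div_eq_0_iff)
    qed
    then have "(\<Sum>i=1..n. if i div gcd i k = j then gcd i k * Poly_Mapping.lookup ?p i else 0) = 0"
      unfolding True by (intro sum.neutral) metis
    then show ?thesis
      using True lk partitions_lookup_eq_0[OF cycle_type_in_partitions[OF sk], of 0] by simp
  next
    case False
    have "j * Poly_Mapping.lookup ?q j = card (period_set {1..n} (s ^^ k) j)"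
      by (simp add: card_period_set_perms[OF sk])
    also have "period_set {1..n} (s ^^ k) j =
        (\<Union>i\<in>{i \<in> {1..n}. i div gcd i k = j}. period_set {1..n} s i)"
    proof (intro equalityI subsetI)
      fix x assume "x \<in> period_set {1..n} (s ^^ k) j"
      then show "x \<in> (\<Union>i\<in>{i \<in> {1..n}. i div gcd i k = j}. period_set {1..n} s i)"
        using least_power_perms[OF assms(1), of x]
        by (simp add: period_set_def least_power_funpow[OF permutation_perms[OF assms(1)] assms(2)])
    qed (auto simp: period_set_def least_power_funpow[OF permutation_perms[OF assms(1)] assms(2)])
    also have "card \<dots> = (\<Sum>i | i \<in> {1..n} \<and> i div gcd i k = j. i * Poly_Mapping.lookup ?p i)"
      unfolding card_period_set_perms[OF assms(1), symmetric]
      by (subst card_UN_disjoint) (auto simp: period_set_def)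
    also have "\<dots> = (\<Sum>i\<in>{1..n}. if i div gcd i k = j then i * Poly_Mapping.lookup ?p i else 0)"
      by (rule sum.inter_filter) simp
    also have "\<dots> = (\<Sum>i\<in>{1..n}. j * (if i div gcd i k = j then gcd i k * Poly_Mapping.lookup ?p i else 0))"
    proof (intro sum.cong refl)
      fix i
      have "i div gcd i k * gcd i k = i" by simp
      then show "(if i div gcd i k = j then i * Poly_Mapping.lookup ?p i else 0) =
          j * (if i div gcd i k = j then gcd i k * Poly_Mapping.lookup ?p i else 0)"
        by (auto simp flip: mult.assoc)
    qed
    also have "\<dots> = j * Poly_Mapping.lookup (power_type k ?p) j"
      by (simp add: lk sum_distrib_left)
    finally show ?thesis using False by simp
  qed
qed

lemma obtain_cycle_type:
  assumes "p \<in> partitions n"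
  obtains s where "s \<in> perms n" "cycle_type n s = p"
proof -
  have "of_nat (card {s \<in> perms n. cycle_type n s = p}) \<noteq> (0 :: rat)"
    using Sym_pos[of n p] by (simp add: card_cycle_type[OF assms])
  then have "{s \<in> perms n. cycle_type n s = p} \<noteq> {}" by (metis card.empty of_nat_0)
  then show ?thesis using that by blast
qed

text \<open>Since p is the type of some permutation s, \<open>power_type k p\<close> is the type of
  s^k; no computation with multiplicities is required.\<close>

lemma power_type_in_partitions:
  assumes "p \<in> partitions n" "k > 0"
  shows "power_type k p \<in> partitions n"
proof -
  obtain s where s: "s \<in> perms n" "cycle_type n s = p" by (rule obtain_cycle_type[OF assms(1)])
  show ?thesis
    using cycle_type_in_partitions[OF perms_funpow[OF s(1), of k]]
    by (simp add: cycle_type_funpow[OF s(1) assms(2)] s(2))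
qed

section \<open>The generating series\<close>

lemma xconst_mult: "xconst a * xconst b = xconst (a * b)"
  by (simp add: xconst_def mult_single)

lemma of_nat_eq_xconst: "of_nat m = xconst (of_nat m)"
  by (simp add: xconst_def single_of_nat)

lemma of_nat_mult_single:
  "of_nat m * Poly_Mapping.single p c = (Poly_Mapping.single p (of_nat m * c) :: xpoly)"
  unfolding single_of_nat[symmetric] by (simp only: mult_single add_0)

text \<open>The chain rule for composition, together with the fact that the series of the 1/k! is
  its own derivative.\<close>

lemma fps_deriv_series_exp:
  assumes "fps_nth F 0 = 0"
  shows "fps_deriv (series_exp F) = series_exp F * fps_deriv F"
proof -
  have "fps_deriv (Abs_fps (\<lambda>k. xconst (1 / fact k))) = Abs_fps (\<lambda>k. xconst (1 / fact k))"
  proof (rule fps_ext)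
    fix k
    have "of_nat (Suc k) * (1 / fact (Suc k)) = (1 / fact k :: rat)"
      by (simp add: fact_Suc del: of_nat_Suc)
    then show "fps_nth (fps_deriv (Abs_fps (\<lambda>k. xconst (1 / fact k)))) k =
        fps_nth (Abs_fps (\<lambda>k. xconst (1 / fact k))) k"
      by (simp add: of_nat_eq_xconst xconst_mult flip: Suc_eq_plus1 del: of_nat_Suc fact_Suc)
  qed
  then show ?thesis
    by (simp add: series_exp_def fps_compose_deriv[OF assms])
qed

text \<open>The coefficient of t^m in Z1' = F' Z1, where F is the exponent of \<open>Z1\<close>.
  Differentiating cancels the denominators of F, leaving x_(i+1) as the coefficient of t^i.\<close>

lemma Z1_recursion:
  "of_nat (Suc m) * fps_nth Z1 (Suc m) = (\<Sum>i=1..Suc m. xvar i * fps_nth Z1 (Suc m - i))"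
proof -
  define F where "F = Abs_fps (\<lambda>i. if i = 0 then 0 else xconst (1 / of_nat i) * xvar i)"
  have F': "fps_nth (fps_deriv F) i = xvar (Suc i)" for i
  proof -
    have "of_nat (Suc i) * xconst (1 / of_nat (Suc i)) = 1"
      by (simp add: of_nat_eq_xconst xconst_mult del: of_nat_Suc) (simp add: xconst_def)
    then show ?thesis
      by (simp add: F_def mult.assoc[symmetric] flip: Suc_eq_plus1 del: of_nat_Suc)
  qed
  have "fps_deriv Z1 = fps_deriv F * Z1"
    unfolding Z1_def F_def[symmetric] by (simp add: fps_deriv_series_exp F_def mult.commute)
  then have "fps_nth (fps_deriv Z1) m = fps_nth (fps_deriv F * Z1) m" by simp
  then have "of_nat (Suc m) * fps_nth Z1 (Suc m) = (\<Sum>i=0..m. xvar (Suc i) * fps_nth Z1 (m - i))"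
    unfolding fps_mult_nth F' by (simp flip: Suc_eq_plus1 del: of_nat_Suc fps_deriv_mult)
  also have "\<dots> = (\<Sum>i=1..Suc m. xvar i * fps_nth Z1 (Suc m - i))"
    unfolding One_nat_def sum.shift_bounds_cl_Suc_ivl by simp
  finally show ?thesis .
qed

text \<open>Multiplied by n, the claimed sum satisfies the recursion of \<open>Z1\<close>:
  multiplication by x_i adds a part i to the monomial, and the factor i (p_i + 1) gained by
  \<open>Sym\<close> cancels against the weight of that part.\<close>

lemma Z1_nth: "fps_nth Z1 n = (\<Sum>p\<in>partitions n. Poly_Mapping.single p (1 / Sym n p))"
proof (induction n rule: less_induct)
  case (less n)
  show ?case
  proof (cases n)
    case 0
    then show ?thesis
      by (simp add: Z1_def series_exp_def fps_compose_nth partitions_0 Sym_def xconst_def)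
  next
    case (Suc m)
    have "of_nat n * (\<Sum>p\<in>partitions n. Poly_Mapping.single p (1 / Sym n p)) =
        (\<Sum>p\<in>partitions n. \<Sum>i\<in>Poly_Mapping.keys p.
          Poly_Mapping.single p (of_nat (i * Poly_Mapping.lookup p i) / Sym n p))"
      unfolding sum_distrib_left
    proof (intro sum.cong refl)
      fix p assume p: "p \<in> partitions n"
      have "of_nat n * Poly_Mapping.single p (1 / Sym n p) = Poly_Mapping.single p (of_nat n / Sym n p)"
        by (simp add: of_nat_mult_single)
      also have "\<dots> = (\<Sum>i\<in>Poly_Mapping.keys p.
          Poly_Mapping.single p (of_nat (i * Poly_Mapping.lookup p i) / Sym n p))"
        unfolding sum_keys_over_Sym[OF p]
        by (rule poly_mapping_eqI) (simp add: lookup_sum lookup_single when_def)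
      finally show "of_nat n * Poly_Mapping.single p (1 / Sym n p) = \<dots>" .
    qed
    also have "\<dots> = (\<Sum>i=1..n. \<Sum>p\<in>partitions (n - i).
        Poly_Mapping.single (p + Poly_Mapping.single i 1) (1 / Sym (n - i) p))"
      unfolding sum_partitions_remove_part
    proof (intro sum.cong refl arg_cong2[where f = Poly_Mapping.single])
      fix i p assume "i \<in> {1..n}" "p \<in> partitions (n - i)"
      then show "of_nat (i * Poly_Mapping.lookup (p + Poly_Mapping.single i 1) i) /
          Sym n (p + Poly_Mapping.single i 1) = 1 / Sym (n - i) p"
        by (subst Sym_add_single) (auto simp: lookup_add simp del: of_nat_mult of_nat_add)
    qed
    also have "\<dots> = (\<Sum>i=1..n. xvar i * fps_nth Z1 (n - i))"
      by (intro sum.cong refl)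
        (simp add: less.IH xvar_def sum_distrib_left mult_single add.commute)
    also have "\<dots> = of_nat n * fps_nth Z1 n"
      unfolding Suc by (rule Z1_recursion[symmetric])
    finally have "of_nat n * (\<Sum>p\<in>partitions n. Poly_Mapping.single p (1 / Sym n p)) =
        of_nat n * fps_nth Z1 n" .
    then show ?thesis using Suc by (simp del: of_nat_Suc)
  qed
qed

text \<open>The common form of the three substitutions: the exponent gcd(i,k) is the number of
  cycles into which an i-cycle breaks, the new index is their length.\<close>

definition Zpow :: "nat \<Rightarrow> xpoly fps" where
  "Zpow k = series_subst (\<lambda>i. xvar (i div gcd i k) ^ gcd i k) Z1"

lemma xvar_power: "xvar i ^ m = Poly_Mapping.single (Poly_Mapping.single i m) 1"
  by (induction m) (simp_all add: xvar_def mult_single single_add[symmetric] plus_1_eq_Suc)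

lemma prod_single:
  "(\<Prod>i\<in>A. Poly_Mapping.single (f i) 1) = (Poly_Mapping.single (sum f A) 1 :: xpoly)"
  by (induction A rule: infinite_finite_induct) (simp_all add: mult_single)

text \<open>The substitution sends the monomial of p to that of \<open>power_type k p\<close>, so
  the coefficient at q collects 1/Sym(p) over the fibre above q.\<close>

lemma Coeff_Zpow:
  "Coeff (Zpow k) n q = (\<Sum>p\<in>partitions n. if power_type k p = q then 1 / Sym n p else 0)"
proof -
  let ?P = "fps_nth Z1 n"
  have lk: "Poly_Mapping.lookup ?P p = (if p \<in> partitions n then 1 / Sym n p else 0)" for p
    by (simp add: Z1_nth lookup_sum lookup_single when_def finite_partitions)
  \<comment> \<open>\<open>xsubst\<close> sums over the support, which is all of
    \<open>partitions n\<close> because no 1/Sym(p) vanishes.\<close>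
  have "Poly_Mapping.keys ?P = partitions n"
    using Sym_pos[of n] by (auto simp: in_keys_iff lk split: if_splits) (metis less_irrefl)
  then have "fps_nth (Zpow k) n = (\<Sum>p\<in>partitions n. xconst (1 / Sym n p) *
      (\<Prod>i\<in>Poly_Mapping.keys p. (xvar (i div gcd i k) ^ gcd i k) ^ Poly_Mapping.lookup p i))"
    by (simp add: Zpow_def series_subst_def xsubst_def lk)
  also have "\<dots> = (\<Sum>p\<in>partitions n. Poly_Mapping.single (power_type k p) (1 / Sym n p))"
    unfolding power_mult[symmetric] xvar_power[of _ "_ * _"] prod_single power_type_def xconst_def
    by (simp add: mult_single)
  finally show ?thesis
    by (simp add: Coeff_def lookup_sum lookup_single when_def)
qed

lemma card_power_cycle_type:
  assumes "k > 0"
  shows "of_nat (card {s \<in> perms n. cycle_type n (s ^^ k) = q}) = fact n * Coeff (Zpow k) n q"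
proof -
  have "of_nat (card {s \<in> perms n. cycle_type n (s ^^ k) = q}) =
      (\<Sum>s\<in>perms n. if power_type k (cycle_type n s) = q then 1 else 0 :: rat)"
    using assms by (simp add: sum.If_cases finite_perms Int_def cycle_type_funpow cong: conj_cong)
  also have "\<dots> = fact n * Coeff (Zpow k) n q"
    unfolding sum_perms_cycle_type[of "\<lambda>p. if power_type k p = q then 1 else 0"] Coeff_Zpow
    by (intro arg_cong2[of _ _ _ _ "(*)"] sum.cong) auto
  finally show ?thesis .
qed

section \<open>Counting k-th roots\<close>

lemma funpow_conjugate:
  assumes "t \<in> perms n"
  shows "(t \<circ> u \<circ> inv t) ^^ k = t \<circ> u ^^ k \<circ> inv t"
proof (induction k)
  case 0
  then show ?case using perms_inv_comp[OF assms] by simp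
next
  case (Suc k)
  have "(t \<circ> u \<circ> inv t) ^^ Suc k = (t \<circ> u \<circ> inv t) \<circ> (t \<circ> u ^^ k \<circ> inv t)"
    by (simp only: funpow.simps Suc.IH)
  also have "\<dots> = t \<circ> (u \<circ> u ^^ k) \<circ> inv t"
    by (simp only: comp_assoc perms_cancel[OF assms])
  finally show ?case by (simp only: funpow.simps)
qed

text \<open>Count the pairs (s, t) with t \<circ> g = s^k \<circ> t. For fixed t, conjugation by t
  identifies the admissible s with the k-th roots of g. For fixed s there are \<open>Sym\<close>
  many t if s^k has the type of g, and none otherwise. The factor n! appears on both sides and
  cancels.\<close>

lemma card_roots:
  assumes g: "g \<in> perms n" and "k > 0"
  shows "of_nat (card {s \<in> perms n. s ^^ k = g}) =
    Coeff (Zpow k) n (cycle_type n g) * Sym n (cycle_type n g)"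
proof -
  have c: "card {s \<in> perms n. t \<circ> g = s ^^ k \<circ> t} = card {s \<in> perms n. s ^^ k = g}"
    if t: "t \<in> perms n" for t
  proof (rule bij_betw_same_card[symmetric])
    have 1: "inv t \<circ> (t \<circ> u \<circ> inv t) \<circ> t = u" "t \<circ> (inv t \<circ> u \<circ> t) \<circ> inv t = u" for u
      by (simp_all only: comp_assoc perms_cancel[OF t] perms_inv_comp[OF t] comp_id)
    have 2: "(inv t \<circ> u \<circ> t) ^^ k = inv t \<circ> u ^^ k \<circ> t" for u
      using funpow_conjugate[OF perms_inv[OF t], where u = u and k = k] t
      by (simp add: perms_def permutes_inv_inv)
    show "bij_betw (\<lambda>u. t \<circ> u \<circ> inv t) {s \<in> perms n. s ^^ k = g} {s \<in> perms n. t \<circ> g = s ^^ k \<circ> t}"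
    proof (rule bij_betw_byWitness[of _ "\<lambda>u. inv t \<circ> u \<circ> t"])
      show "(\<lambda>u. t \<circ> u \<circ> inv t) ` {s \<in> perms n. s ^^ k = g} \<subseteq> {s \<in> perms n. t \<circ> g = s ^^ k \<circ> t}"
      proof clarify
        fix s assume s: "s \<in> perms n" "g = s ^^ k"
        show "t \<circ> s \<circ> inv t \<in> perms n \<and> t \<circ> s ^^ k = (t \<circ> s \<circ> inv t) ^^ k \<circ> t"
          using s t
          by (simp add: perms_comp perms_inv funpow_conjugate[OF t])
            (simp only: comp_assoc perms_inv_comp[OF t] comp_id)
      qed
      show "(\<lambda>u. inv t \<circ> u \<circ> t) ` {s \<in> perms n. t \<circ> g = s ^^ k \<circ> t} \<subseteq> {s \<in> perms n. s ^^ k = g}"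
      proof clarify
        fix s assume s: "s \<in> perms n" and eq: "t \<circ> g = s ^^ k \<circ> t"
        have "inv t \<circ> s ^^ k \<circ> t = g" by (simp only: comp_assoc eq[symmetric] perms_cancel[OF t])
        then show "inv t \<circ> s \<circ> t \<in> perms n \<and> (inv t \<circ> s \<circ> t) ^^ k = g"
          using s t by (simp add: 2 perms_comp perms_inv)
      qed
    qed (intro ballI, rule 1)+
  qed
  have "fact n * card {s \<in> perms n. s ^^ k = g} = (\<Sum>t\<in>perms n. card {s \<in> perms n. s ^^ k = g})"
    by (simp add: card_perms)
  also have "\<dots> = (\<Sum>t\<in>perms n. card {s \<in> perms n. t \<circ> g = s ^^ k \<circ> t})"
    by (intro sum.cong refl c[symmetric])
  also have "\<dots> = (\<Sum>s\<in>perms n. card {t \<in> perms n. t \<circ> g = s ^^ k \<circ> t})"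
    by (intro sum_card_swap finite_perms)
  finally have "of_nat (fact n * card {s \<in> perms n. s ^^ k = g}) =
      (\<Sum>s\<in>perms n. of_nat (card {t \<in> perms n. t \<circ> g = s ^^ k \<circ> t}) :: rat)"
    by (simp only: of_nat_sum)
  also have "\<dots> = (\<Sum>s\<in>perms n. if cycle_type n (s ^^ k) = cycle_type n g
      then Sym n (cycle_type n g) else 0)"
    by (intro sum.cong refl) (simp add: card_intertwining_perms[OF g perms_funpow] eq_commute)
  also have "\<dots> = of_nat (card {s \<in> perms n. cycle_type n (s ^^ k) = cycle_type n g}) *
      Sym n (cycle_type n g)"
    by (simp add: sum.If_cases finite_perms Int_def)
  finally show ?thesis by (simp add: card_power_cycle_type[OF assms(2)])
qed

section \<open>Burnside's lemma\<close>

text \<open>The pairs (g, x) with g x = x are counted by x; on each class the stabilizer orders add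
  up to |G| by the orbit-stabilizer theorem. The group enters as injective translations and
  injective actions on plain sets, the form in which the triples are available.\<close>

lemma burnside_count:
  assumes fin: "finite G" "finite X" and R: "equiv X R"
    and mul: "\<And>g h. g \<in> G \<Longrightarrow> h \<in> G \<Longrightarrow> mul g h \<in> G" "\<And>g. g \<in> G \<Longrightarrow> inj_on (mul g) G"
    and act: "\<And>g x. g \<in> G \<Longrightarrow> x \<in> X \<Longrightarrow> act g x \<in> X" "\<And>g. g \<in> G \<Longrightarrow> inj_on (act g) X"
    and act_mul: "\<And>g h x. g \<in> G \<Longrightarrow> h \<in> G \<Longrightarrow> x \<in> X \<Longrightarrow> act (mul g h) x = act g (act h x)"
    and orbits: "\<And>x y. x \<in> X \<Longrightarrow> (x, y) \<in> R \<longleftrightarrow> (\<exists>g\<in>G. act g x = y)"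
  shows "(\<Sum>g\<in>G. card {x \<in> X. act g x = x}) = card G * card (X // R)"
proof -
  let ?stab = "\<lambda>x. {h \<in> G. act h x = x}"
  \<comment> \<open>Translation by g carries the stabilizer of x onto the elements sending x to g x.
    It is onto G because an injective self-map of a finite set is surjective.\<close>
  have coset: "card {h \<in> G. act h x = act g x} = card (?stab x)"
    if g: "g \<in> G" and x: "x \<in> X" for g x
  proof -
    have onto: "mul g ` G = G"
      using mul(1)[OF g] by (intro endo_inj_surj fin mul(2)[OF g]) auto
    have iff: "act (mul g h) x = act g x \<longleftrightarrow> act h x = x" if "h \<in> G" for h
      using act_mul[OF g that x] inj_on_eq_iff[OF act(2)[OF g] act(1)[OF that x] x] by simp
    have "mul g ` ?stab x = {h \<in> G. act h x = act g x}"
    proof (intro equalityI subsetI)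
      fix h assume "h \<in> {h \<in> G. act h x = act g x}"
      moreover then obtain h' where "h' \<in> G" "h = mul g h'" using onto by blast
      ultimately show "h \<in> mul g ` ?stab x" using iff by auto
    qed (use iff mul(1)[OF g] in auto)
    then show ?thesis
      using card_image[OF inj_on_subset[OF mul(2)[OF g]], of "?stab x"] by auto
  qed
  have orbit_sum: "(\<Sum>x\<in>C. card (?stab x)) = card G" if C: "C \<in> X // R" for C
  proof -
    have finC: "finite C" by (rule finite_subset[OF in_quotient_imp_subset[OF R C] fin(2)])
    have stab: "card C * card (?stab x) = card G" if x: "x \<in> C" for x
    proof -
      have xX: "x \<in> X" using C x R by (meson in_quotient_imp_subset subsetD)
      have "R `` {x} = C"
        using C x R xX by (metis Image_singleton_iff equiv_class_self quotient_eqI quotient_eq_iff quotientI)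
      then have C_eq: "C = {y. \<exists>g\<in>G. act g x = y}" using orbits[OF xX] by auto
      have "G = (\<Union>y\<in>C. {h \<in> G. act h x = y})" unfolding C_eq by auto
      then have "card G = card (\<Union>y\<in>C. {h \<in> G. act h x = y})" by (rule arg_cong)
      also have "\<dots> = (\<Sum>y\<in>C. card {h \<in> G. act h x = y})"
        by (rule card_UN_disjoint) (use finC fin(1) in auto)
      also have "\<dots> = (\<Sum>y\<in>C. card (?stab x))"
      proof (intro sum.cong refl)
        fix y assume "y \<in> C"
        then obtain g where "g \<in> G" "y = act g x" unfolding C_eq by blast
        then show "card {h \<in> G. act h x = y} = card (?stab x)" using coset[OF _ xX] by simp
      qed
      finally show ?thesis by simp
    qed
    have "C \<noteq> {}" by (rule in_quotient_imp_non_empty[OF R C])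
    \<comment> \<open>Multiplying by |C| makes every summand equal to |G|; afterwards |C| is
      cancelled, C being finite and nonempty.\<close>
    have "card C * (\<Sum>x\<in>C. card (?stab x)) = card C * card G"
      using stab by (simp add: sum_distrib_left)
    then show ?thesis using finC \<open>C \<noteq> {}\<close> by simp
  qed
  have "(\<Sum>g\<in>G. card {x \<in> X. act g x = x}) = (\<Sum>x\<in>X. card (?stab x))"
    by (rule sum_card_swap[OF fin])
  also have "\<dots> = (\<Sum>x\<in>\<Union>(X // R). card (?stab x))"
    by (simp add: Union_quotient[OF R])
  also have "\<dots> = (\<Sum>C\<in>X // R. \<Sum>x\<in>C. card (?stab x))"
  proof (rule sum.Union_disjoint[unfolded comp_def])
    show "\<forall>C\<in>X // R. finite C"
      using finite_subset[OF in_quotient_imp_subset[OF R] fin(2)] by blast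
    show "\<forall>C\<in>X // R. \<forall>D\<in>X // R. C \<noteq> D \<longrightarrow> C \<inter> D = {}"
      using quotient_disj[OF R] by blast
  qed
  also have "\<dots> = (\<Sum>C\<in>X // R. card G)"
    by (intro sum.cong refl orbit_sum)
  finally show ?thesis by simp
qed

section \<open>The group action on tuples\<close>

fun tuple_act :: "(nat \<Rightarrow> nat) \<times> (nat \<Rightarrow> nat) \<times> (nat \<Rightarrow> nat) \<Rightarrow>
    (nat \<Rightarrow> nat \<Rightarrow> nat) \<Rightarrow> (nat \<Rightarrow> nat \<Rightarrow> nat)" where
  "tuple_act (\<alpha>, \<gamma>\<^sub>1, \<gamma>\<^sub>2) \<sigma> = (\<lambda>a\<in>{1..4}. \<gamma>\<^sub>1 \<circ> \<sigma> (\<alpha> a) \<circ> \<gamma>\<^sub>2)"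

text \<open>The order is reversed in the first and third components because \<alpha> and the second
  \<gamma> are composed on the right. This makes \<open>tuple_act\<close> a left action.\<close>

fun tuple_mul :: "(nat \<Rightarrow> nat) \<times> (nat \<Rightarrow> nat) \<times> (nat \<Rightarrow> nat) \<Rightarrow>
    (nat \<Rightarrow> nat) \<times> (nat \<Rightarrow> nat) \<times> (nat \<Rightarrow> nat) \<Rightarrow>
    (nat \<Rightarrow> nat) \<times> (nat \<Rightarrow> nat) \<times> (nat \<Rightarrow> nat)" where
  "tuple_mul (\<alpha>, \<gamma>\<^sub>1, \<gamma>\<^sub>2) (\<alpha>', \<gamma>\<^sub>1', \<gamma>\<^sub>2') = (\<alpha>' \<circ> \<alpha>, \<gamma>\<^sub>1 \<circ> \<gamma>\<^sub>1', \<gamma>\<^sub>2' \<circ> \<gamma>\<^sub>2)"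

definition tuple_group :: "nat \<Rightarrow> ((nat \<Rightarrow> nat) \<times> (nat \<Rightarrow> nat) \<times> (nat \<Rightarrow> nat)) set" where
  "tuple_group n = perms 4 \<times> perms n \<times> perms n"

lemma perms_mem: "\<alpha> \<in> perms m \<Longrightarrow> a \<in> {1..m} \<Longrightarrow> \<alpha> a \<in> {1..m}"
  using perms_image by blast

lemma tuple_act_in_tuples:
  assumes "g \<in> tuple_group n" "\<sigma> \<in> tuples n"
  shows "tuple_act g \<sigma> \<in> tuples n"
proof -
  obtain \<alpha> \<gamma> \<delta> where g: "g = (\<alpha>, \<gamma>, \<delta>)" by (cases g)
  have p: "\<alpha> \<in> perms 4" "\<gamma> \<in> perms n" "\<delta> \<in> perms n" using assms by (auto simp: g tuple_group_def)
  have "\<sigma> (\<alpha> a) \<in> perms n" if "a \<in> {1..4}" for a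
    using assms(2) perms_mem[OF p(1) that] unfolding tuples_def by (rule PiE_mem)
  then show ?thesis
    unfolding tuples_def g tuple_act.simps restrict_PiE_iff
    by (intro ballI perms_comp p(2,3))
qed

lemma tuple_mul_in_group:
  "g \<in> tuple_group n \<Longrightarrow> h \<in> tuple_group n \<Longrightarrow> tuple_mul g h \<in> tuple_group n"
  by (cases g; cases h) (auto simp: tuple_group_def perms_comp)

lemma tuple_act_mul:
  assumes "g \<in> tuple_group n"
  shows "tuple_act (tuple_mul g h) \<sigma> = tuple_act g (tuple_act h \<sigma>)"
proof -
  obtain \<alpha> \<gamma> \<delta> where g: "g = (\<alpha>, \<gamma>, \<delta>)" by (cases g)
  obtain \<alpha>' \<gamma>' \<delta>' where h: "h = (\<alpha>', \<gamma>', \<delta>')" by (cases h)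
  have \<alpha>: "\<alpha> \<in> perms 4" using assms by (simp add: g tuple_group_def)
  show ?thesis
    unfolding g h tuple_mul.simps tuple_act.simps
  proof (rule restrict_ext)
    fix a :: nat assume "a \<in> {1..4}"
    from perms_mem[OF \<alpha> this] show "\<gamma> \<circ> \<gamma>' \<circ> \<sigma> ((\<alpha>' \<circ> \<alpha>) a) \<circ> (\<delta>' \<circ> \<delta>) =
        \<gamma> \<circ> (\<lambda>a\<in>{1..4}. \<gamma>' \<circ> \<sigma> (\<alpha>' a) \<circ> \<delta>') (\<alpha> a) \<circ> \<delta>"
      by (simp add: comp_assoc del: atLeastAtMost_iff)
  qed
qed

text \<open>The componentwise inverse undoes the action as well as multiplication from the left. The
  first reverses single steps of the equivalence, and both supply the injectivity that orbit
  counting asks for.\<close>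

lemma tuple_act_inverse:
  assumes "g \<in> tuple_group n"
  obtains h where "h \<in> tuple_group n"
    "\<And>\<sigma>. \<sigma> \<in> tuples n \<Longrightarrow> tuple_act h (tuple_act g \<sigma>) = \<sigma>"
    "\<And>k. tuple_mul h (tuple_mul g k) = k"
proof -
  obtain \<alpha> \<gamma> \<delta> where g: "g = (\<alpha>, \<gamma>, \<delta>)" by (cases g)
  have p: "\<alpha> \<in> perms 4" "\<gamma> \<in> perms n" "\<delta> \<in> perms n" using assms by (auto simp: g tuple_group_def)
  let ?h = "(inv \<alpha>, inv \<gamma>, inv \<delta>)"
  have h: "?h \<in> tuple_group n" using p by (simp add: tuple_group_def perms_inv)
  show ?thesis
  proof (rule that[OF h])
    fix \<sigma> assume \<sigma>: "\<sigma> \<in> tuples n"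
    show "tuple_act ?h (tuple_act g \<sigma>) = \<sigma>"
    proof
      fix a show "tuple_act ?h (tuple_act g \<sigma>) a = \<sigma> a"
      proof (cases "a \<in> {1..4}")
        case True
        have 1: "\<alpha> (inv \<alpha> a) = a" using perms_inv_comp(1)[OF p(1)] by (metis comp_apply id_apply)
        have 2: "inv \<alpha> a \<in> {1..4}" by (rule perms_mem[OF perms_inv[OF p(1)] True])
        have "inv \<gamma> \<circ> (\<gamma> \<circ> \<sigma> a \<circ> \<delta>) \<circ> inv \<delta> = \<sigma> a"
          by (simp only: comp_assoc perms_cancel[OF p(2)] perms_inv_comp[OF p(3)] comp_id)
        then show ?thesis using True 1 2 by (simp add: g del: atLeastAtMost_iff)
      next
        case False
        then show ?thesis using \<sigma> by (auto simp: g tuples_def PiE_def extensional_def)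
      qed
    qed
  next
    fix k show "tuple_mul ?h (tuple_mul g k) = k"
    proof (cases k)
      case (fields a b c)
      have "c \<circ> \<delta> \<circ> inv \<delta> = c" "a \<circ> \<alpha> \<circ> inv \<alpha> = a"
        by (simp_all only: comp_assoc perms_inv_comp[OF p(3)] perms_inv_comp[OF p(1)] comp_id)
      then show ?thesis by (simp add: fields g perms_cancel[OF p(2)])
    qed
  qed
qed

lemma finite_tuples: "finite (tuples n)"
  by (simp add: tuples_def finite_PiE finite_perms)

lemma equiv_sc_equiv: "equiv (tuples n) (sc_equiv n)"
proof (rule equivI)
  show "sc_equiv n \<subseteq> tuples n \<times> tuples n" by (auto simp: sc_equiv_def)
  show "refl_on (tuples n) (sc_equiv n)"
    by (auto simp: refl_on_def sc_equiv_def reflpD[OF reflp_equivclp])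
  show "sym (sc_equiv n)" by (auto simp: sym_def sc_equiv_def intro: equivclp_sym)
  show "trans (sc_equiv n)" by (auto simp: trans_def sc_equiv_def intro: equivclp_trans)
qed

text \<open>Along a chain of steps the acting elements multiply up, with inverses for steps taken
  backwards. Conversely a triple acts as one recolouring followed by one two-sided
  multiplication.\<close>

lemma sc_equiv_iff:
  assumes \<sigma>: "\<sigma> \<in> tuples n"
  shows "(\<sigma>, \<tau>) \<in> sc_equiv n \<longleftrightarrow> (\<exists>g\<in>tuple_group n. tuple_act g \<sigma> = \<tau>)"
proof
  have step: "\<exists>g\<in>tuple_group n. tuple_act g u = v" if uv: "sc_step n u v" for u v
    using uv
  proof cases
    case (left_right \<gamma>\<^sub>1 \<gamma>\<^sub>2)
    have "tuple_act (id, \<gamma>\<^sub>1, \<gamma>\<^sub>2) u = v" by (simp add: left_right)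
    then show ?thesis
      using left_right by (intro bexI[of _ "(id, \<gamma>\<^sub>1, \<gamma>\<^sub>2)"]) (auto simp: tuple_group_def perms_def)
  next
    case (recolour \<alpha>)
    have "tuple_act (\<alpha>, id, id) u = v" by (simp add: recolour)
    then show ?thesis
      using recolour by (intro bexI[of _ "(\<alpha>, id, id)"]) (auto simp: tuple_group_def perms_def)
  qed
  \<comment> \<open>The inverse undoes the action only on \<open>tuples n\<close>. A step taken
    backwards ends at the source of a step, which this places there.\<close>
  have step_src: "u \<in> tuples n" if "sc_step n u v" for u v
    using that by cases auto
  assume "(\<sigma>, \<tau>) \<in> sc_equiv n"
  then have "equivclp (sc_step n) \<sigma> \<tau>" by (simp add: sc_equiv_def)
  then show "\<exists>g\<in>tuple_group n. tuple_act g \<sigma> = \<tau>"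
  proof induction
    case base
    have "tuple_act (id, id, id) \<sigma> = \<sigma>"
      using \<sigma> by (auto simp: fun_eq_iff tuples_def PiE_def extensional_def)
    then show ?case
      by (intro bexI[of _ "(id, id, id)"]) (auto simp: tuple_group_def perms_def permutes_id)
  next
    case (step y z)
    then obtain g where g: "g \<in> tuple_group n" "tuple_act g \<sigma> = y" by blast
    obtain h where h: "h \<in> tuple_group n" "tuple_act h y = z"
    proof (cases "sc_step n y z")
      case True
      then show ?thesis using \<open>sc_step n y z \<Longrightarrow> \<exists>g\<in>tuple_group n. tuple_act g y = z\<close> that by blast
    next
      case False
      then have zy: "sc_step n z y" using step.hyps by blast
      then obtain k where k: "k \<in> tuple_group n" "tuple_act k z = y"
        using \<open>sc_step n z y \<Longrightarrow> \<exists>g\<in>tuple_group n. tuple_act g z = y\<close> by blast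
      obtain h where "h \<in> tuple_group n"
        "\<And>\<sigma>. \<sigma> \<in> tuples n \<Longrightarrow> tuple_act h (tuple_act k \<sigma>) = \<sigma>"
        using tuple_act_inverse[OF k(1)] by metis
      then show ?thesis using that step_src[OF zy] k(2) by blast
    qed
    have "tuple_act (tuple_mul h g) \<sigma> = z" using tuple_act_mul[OF h(1)] g(2) h(2) by simp
    then show ?case using tuple_mul_in_group[OF h(1) g(1)] by blast
  qed
next
  assume "\<exists>g\<in>tuple_group n. tuple_act g \<sigma> = \<tau>"
  then obtain \<alpha> \<gamma>\<^sub>1 \<gamma>\<^sub>2 where g: "(\<alpha>, \<gamma>\<^sub>1, \<gamma>\<^sub>2) \<in> tuple_group n" and \<tau>: "\<tau> = tuple_act (\<alpha>, \<gamma>\<^sub>1, \<gamma>\<^sub>2) \<sigma>"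
    by (metis prod_cases3)
  \<comment> \<open>The intermediate tuple, recoloured but not yet multiplied.\<close>
  let ?u = "\<lambda>a\<in>{1..4}. \<sigma> (\<alpha> a)"
  have p: "\<alpha> permutes {1..4}" "\<gamma>\<^sub>1 \<in> perms n" "\<gamma>\<^sub>2 \<in> perms n"
    using g by (auto simp: tuple_group_def perms_def)
  have "?u = tuple_act (\<alpha>, id, id) \<sigma>" by simp
  also have "\<dots> \<in> tuples n"
    using p \<sigma> by (intro tuple_act_in_tuples) (auto simp: tuple_group_def perms_def permutes_id)
  finally have u: "?u \<in> tuples n" .
  have "sc_step n \<sigma> ?u" by (rule sc_step.recolour[OF \<sigma> p(1)])
  moreover have "sc_step n ?u \<tau>"
  proof -
    have "\<tau> = (\<lambda>a\<in>{1..4}. \<gamma>\<^sub>1 \<circ> ?u a \<circ> \<gamma>\<^sub>2)" by (auto simp: \<tau> fun_eq_iff)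
    then show ?thesis using sc_step.left_right[OF u p(2,3)] by simp
  qed
  ultimately have "equivclp (sc_step n) \<sigma> \<tau>"
    by (meson equivclp_trans r_into_equivclp)
  moreover have "\<tau> \<in> tuples n" unfolding \<tau> by (rule tuple_act_in_tuples[OF g \<sigma>])
  ultimately show "(\<sigma>, \<tau>) \<in> sc_equiv n" using \<sigma> by (simp add: sc_equiv_def)
qed

lemma Z4_sc_burnside:
  "(\<Sum>g\<in>tuple_group n. card {\<sigma> \<in> tuples n. tuple_act g \<sigma> = \<sigma>}) = 24 * (fact n)\<^sup>2 * Z4_sc n"
proof -
  have inj: "inj_on (tuple_act g) (tuples n)" "inj_on (tuple_mul g) (tuple_group n)"
    if g: "g \<in> tuple_group n" for g
  proof -
    obtain h where h: "\<And>\<sigma>. \<sigma> \<in> tuples n \<Longrightarrow> tuple_act h (tuple_act g \<sigma>) = \<sigma>"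
      "\<And>k. tuple_mul h (tuple_mul g k) = k"
      using tuple_act_inverse[OF g] by metis
    show "inj_on (tuple_act g) (tuples n)" by (rule inj_on_inverseI[where g = "tuple_act h"]) (rule h(1))
    show "inj_on (tuple_mul g) (tuple_group n)" by (rule inj_on_inverseI[where g = "tuple_mul h"]) (rule h(2))
  qed
  have fin: "finite (tuple_group n)" by (simp add: tuple_group_def finite_perms)
  have "(\<Sum>g\<in>tuple_group n. card {\<sigma> \<in> tuples n. tuple_act g \<sigma> = \<sigma>}) =
      card (tuple_group n) * card (tuples n // sc_equiv n)"
    by (rule burnside_count[OF fin finite_tuples equiv_sc_equiv tuple_mul_in_group inj(2)
          tuple_act_in_tuples inj(1) tuple_act_mul sc_equiv_iff])
  also have "card (tuple_group n) = 24 * (fact n)\<^sup>2"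
    by (simp add: tuple_group_def card_cartesian_product card_perms power2_eq_square fact_numeral)
  finally show ?thesis by (simp add: Z4_sc_def)
qed

section \<open>Counting fixed tuples\<close>

lemma inv_funpow_perms:
  assumes "s \<in> perms n"
  shows "inv (s ^^ k) = inv s ^^ k"
  using assms by (intro inv_fn) (auto simp: perms_def permutes_bij)

text \<open>Inversion keeps the orbits, and the period of a point is the size of its orbit.\<close>

lemma cycle_type_inv:
  assumes "s \<in> perms n"
  shows "cycle_type n (inv s) = cycle_type n s"
proof -
  note p = permutation_perms[OF assms] permutation_perms[OF perms_inv[OF assms]]
  have "least_power (inv s) = least_power s"
    using orbit_inv_eq[OF p(1)] card_orbit_eq_least_power[OF p(1)]
      card_orbit_eq_least_power[OF p(2)] by (intro ext) metis
  then show ?thesis by (simp add: cycle_type_def num_cycles_def[abs_def] period_set_def)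
qed

lemma card_fixed_two_sided:
  assumes a: "a \<in> perms n" and b: "b \<in> perms n"
  shows "of_nat (card {u \<in> perms n. ((\<lambda>u. inv a \<circ> u \<circ> inv b) ^^ k) u = u}) =
    (if cycle_type n (a ^^ k) = cycle_type n (b ^^ k) then Sym n (cycle_type n (a ^^ k)) else 0)"
proof -
  have T: "((\<lambda>u. inv a \<circ> u \<circ> inv b) ^^ k) u = inv a ^^ k \<circ> u \<circ> inv b ^^ k" for u
  proof (induction k)
    case (Suc k)
    have "((\<lambda>u. inv a \<circ> u \<circ> inv b) ^^ Suc k) u =
        inv a \<circ> (inv a ^^ k \<circ> u \<circ> inv b ^^ k) \<circ> inv b"
      by (subst funpow.simps(2), subst comp_apply, subst Suc.IH, rule refl)
    also have "inv a \<circ> (inv a ^^ k \<circ> u \<circ> inv b ^^ k) \<circ> inv b = inv a ^^ Suc k \<circ> u \<circ> inv b ^^ Suc k"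
      by (simp only: funpow.simps(2)[of k "inv a"] funpow_Suc_right[of k "inv b"] comp_assoc)
    finally show ?case .
  qed simp
  have ak: "a ^^ k \<in> perms n" and bk: "inv b ^^ k \<in> perms n"
    using a b by (auto intro: perms_funpow perms_inv)
  have "inv a ^^ k \<circ> u \<circ> inv b ^^ k = u \<longleftrightarrow> u \<circ> inv b ^^ k = a ^^ k \<circ> u" for u
    unfolding inv_funpow_perms[OF a, symmetric]
    by (metis comp_assoc perms_cancel[OF ak])
  then have "{u \<in> perms n. ((\<lambda>u. inv a \<circ> u \<circ> inv b) ^^ k) u = u} =
      {u \<in> perms n. u \<circ> inv b ^^ k = a ^^ k \<circ> u}"
    unfolding T by blast
  moreover have "cycle_type n (inv b ^^ k) = cycle_type n (b ^^ k)"
    using cycle_type_inv[OF perms_funpow[OF b]] by (simp add: inv_funpow_perms[OF b])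
  ultimately show ?thesis using card_intertwining_perms[OF bk ak] by simp
qed

text \<open>The number of values available to one point of a k-cycle of the recolouring, when the
  left and right factors have cycle types p and q.\<close>

definition common_power_weight :: "nat \<Rightarrow> nat \<Rightarrow> (nat \<Rightarrow>\<^sub>0 nat) \<Rightarrow> (nat \<Rightarrow>\<^sub>0 nat) \<Rightarrow> rat" where
  "common_power_weight n k p q =
    (if power_type k p = power_type k q then Sym n (power_type k p) else 0)"

lemma card_fixed_tuples:
  assumes \<alpha>: "\<alpha> \<in> perms 4" and a: "a \<in> perms n" and b: "b \<in> perms n"
  shows "of_nat (card {\<sigma> \<in> tuples n. tuple_act (\<alpha>, a, b) \<sigma> = \<sigma>}) =
    (\<Prod>i=1..4. common_power_weight n i (cycle_type n a) (cycle_type n b) ^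
      Poly_Mapping.lookup (cycle_type 4 \<alpha>) i)"
proof -
  let ?T = "\<lambda>u. inv a \<circ> u \<circ> inv b"
  \<comment> \<open>The fixed point equation a \<circ> \<sigma> (\<alpha> i) \<circ> b = \<sigma> i
    is solved for \<sigma> (\<alpha> i); the inverses in \<open>?T\<close> come from here.\<close>
  have fixed: "tuple_act (\<alpha>, a, b) \<sigma> = \<sigma> \<longleftrightarrow> (\<forall>i\<in>{1..4}. \<sigma> (\<alpha> i) = ?T (\<sigma> i))"
    if \<sigma>: "\<sigma> \<in> tuples n" for \<sigma>
  proof -
    have "tuple_act (\<alpha>, a, b) \<sigma> = \<sigma> \<longleftrightarrow> (\<forall>i\<in>{1..4}. a \<circ> \<sigma> (\<alpha> i) \<circ> b = \<sigma> i)"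
    proof
      assume eq: "tuple_act (\<alpha>, a, b) \<sigma> = \<sigma>"
      show "\<forall>i\<in>{1..4}. a \<circ> \<sigma> (\<alpha> i) \<circ> b = \<sigma> i"
      proof
        fix i :: nat assume "i \<in> {1..4}"
        then show "a \<circ> \<sigma> (\<alpha> i) \<circ> b = \<sigma> i" using fun_cong[OF eq, of i] by simp
      qed
    next
      assume eq: "\<forall>i\<in>{1..4}. a \<circ> \<sigma> (\<alpha> i) \<circ> b = \<sigma> i"
      show "tuple_act (\<alpha>, a, b) \<sigma> = \<sigma>"
      proof
        fix i show "tuple_act (\<alpha>, a, b) \<sigma> i = \<sigma> i"
          using eq \<sigma> by (cases "i \<in> {1..4}") (auto simp: tuples_def PiE_def extensional_def)
      qed
    qed
    moreover have "a \<circ> u \<circ> b = v \<longleftrightarrow> u = ?T v" for u v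
    proof
      assume "a \<circ> u \<circ> b = v"
      then show "u = ?T v"
        by (auto simp only: comp_assoc perms_cancel[OF a] perms_inv_comp[OF b] comp_id)
    next
      assume "u = ?T v"
      then show "a \<circ> u \<circ> b = v"
        by (auto simp only: comp_assoc perms_cancel[OF a] perms_inv_comp[OF b] comp_id)
    qed
    ultimately show ?thesis by blast
  qed
  have "{\<sigma> \<in> tuples n. tuple_act (\<alpha>, a, b) \<sigma> = \<sigma>} = equivariant_maps {1..4} \<alpha> (perms n) ?T"
  proof (intro equalityI subsetI)
    fix \<sigma> assume "\<sigma> \<in> {\<sigma> \<in> tuples n. tuple_act (\<alpha>, a, b) \<sigma> = \<sigma>}"
    then show "\<sigma> \<in> equivariant_maps {1..4} \<alpha> (perms n) ?T"
      using fixed[of \<sigma>] by (simp add: equivariant_maps_def tuples_def del: tuple_act.simps)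
  next
    fix \<sigma> assume "\<sigma> \<in> equivariant_maps {1..4} \<alpha> (perms n) ?T"
    then show "\<sigma> \<in> {\<sigma> \<in> tuples n. tuple_act (\<alpha>, a, b) \<sigma> = \<sigma>}"
      using fixed[of \<sigma>] by (simp add: equivariant_maps_def tuples_def del: tuple_act.simps)
  qed
  then have "card {\<sigma> \<in> tuples n. tuple_act (\<alpha>, a, b) \<sigma> = \<sigma>} =
      card (equivariant_maps {1..4} \<alpha> (perms n) ?T)" by (rule arg_cong)
  also have "\<dots> = (\<Prod>i=1..4. card {u \<in> perms n. (?T ^^ i) u = u} ^ num_cycles {1..4} \<alpha> i)"
  proof (rule card_equivariant_maps[OF permutation_perms[OF \<alpha>] perms_image[OF \<alpha>]
        finite_atLeastAtMost _ finite_atLeastAtMost])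
    show "?T ` perms n \<subseteq> perms n" by (intro image_subsetI perms_comp perms_inv a b)
    show "least_power \<alpha> ` {1..4} \<subseteq> {1..4}"
      by (intro image_subsetI least_power_perms[OF \<alpha>])
  qed
  finally have "of_nat (card {\<sigma> \<in> tuples n. tuple_act (\<alpha>, a, b) \<sigma> = \<sigma>}) =
      (of_nat (\<Prod>i=1..4. card {u \<in> perms n. (?T ^^ i) u = u} ^ num_cycles {1..4} \<alpha> i) :: rat)"
    by (rule arg_cong)
  also have "\<dots> = (\<Prod>i=1..4. of_nat (card {u \<in> perms n. (?T ^^ i) u = u}) ^
        Poly_Mapping.lookup (cycle_type 4 \<alpha>) i)"
    by (simp only: of_nat_prod of_nat_power lookup_cycle_type[OF \<alpha>])
  also have "\<dots> = (\<Prod>i=1..4. common_power_weight n i (cycle_type n a) (cycle_type n b) ^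
      Poly_Mapping.lookup (cycle_type 4 \<alpha>) i)"
  proof (intro prod.cong refl arg_cong2[where f = "(^)"])
    fix i :: nat assume "i \<in> {1..4}"
    then have i: "i > 0" by simp
    show "of_nat (card {u \<in> perms n. (?T ^^ i) u = u}) =
        common_power_weight n i (cycle_type n a) (cycle_type n b)"
      unfolding card_fixed_two_sided[OF a b] common_power_weight_def
        cycle_type_funpow[OF a i] cycle_type_funpow[OF b i] by (rule refl)
  qed
  finally show ?thesis .
qed

text \<open>The number of tuples fixed together with a recolouring of type r, averaged over all
  pairs of left and right factors: a cycle type p has frequency 1/Sym(p).\<close>

definition recolouring_sum :: "nat \<Rightarrow> (nat \<Rightarrow>\<^sub>0 nat) \<Rightarrow> rat" where
  "recolouring_sum n r = (\<Sum>p\<in>partitions n. \<Sum>q\<in>partitions n.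
    (\<Prod>i=1..4. common_power_weight n i p q ^ Poly_Mapping.lookup r i) / (Sym n p * Sym n q))"

lemma Z4_sc_eq_sum_recolouring:
  "of_nat (Z4_sc n) = (\<Sum>r\<in>partitions 4. recolouring_sum n r / Sym 4 r)"
proof -
  let ?h = "\<lambda>r p q. \<Prod>i=1..4. common_power_weight n i p q ^ Poly_Mapping.lookup r i"
  have "of_nat (24 * (fact n)\<^sup>2 * Z4_sc n) = (\<Sum>g\<in>tuple_group n.
      of_nat (card {\<sigma> \<in> tuples n. tuple_act g \<sigma> = \<sigma>}) :: rat)"
    unfolding Z4_sc_burnside[symmetric] by simp
  also have "\<dots> = (\<Sum>\<alpha>\<in>perms 4. \<Sum>a\<in>perms n. \<Sum>b\<in>perms n.
      of_nat (card {\<sigma> \<in> tuples n. tuple_act (\<alpha>, a, b) \<sigma> = \<sigma>}))"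
    unfolding tuple_group_def by (simp only: sum.cartesian_product case_prod_unfold prod.collapse)
  also have "\<dots> = (\<Sum>\<alpha>\<in>perms 4. \<Sum>a\<in>perms n. \<Sum>b\<in>perms n.
      ?h (cycle_type 4 \<alpha>) (cycle_type n a) (cycle_type n b))"
    by (intro sum.cong refl card_fixed_tuples)
  also have "\<dots> = fact 4 * (\<Sum>r\<in>partitions 4. (\<Sum>a\<in>perms n. \<Sum>b\<in>perms n.
      ?h r (cycle_type n a) (cycle_type n b)) / Sym 4 r)"
    by (rule sum_perms_cycle_type)
  also have "\<dots> = fact 4 * (\<Sum>r\<in>partitions 4. (fact n)\<^sup>2 * recolouring_sum n r / Sym 4 r)"
  proof (intro arg_cong2[where f = "(*)"] arg_cong2[where f = "(/)"] sum.cong refl)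
    fix r
    have "(\<Sum>a\<in>perms n. \<Sum>b\<in>perms n. ?h r (cycle_type n a) (cycle_type n b)) =
        (\<Sum>a\<in>perms n. fact n * (\<Sum>q\<in>partitions n. ?h r (cycle_type n a) q / Sym n q))"
      by (intro sum.cong refl sum_perms_cycle_type)
    also have "\<dots> = fact n * (\<Sum>p\<in>partitions n.
        fact n * (\<Sum>q\<in>partitions n. ?h r p q / Sym n q) / Sym n p)"
      by (rule sum_perms_cycle_type)
    also have "\<dots> = (fact n)\<^sup>2 * recolouring_sum n r"
      unfolding recolouring_sum_def
      by (simp add: sum_distrib_left sum_divide_distrib power2_eq_square mult_ac)
    finally show "(\<Sum>a\<in>perms n. \<Sum>b\<in>perms n. ?h r (cycle_type n a) (cycle_type n b)) =
        (fact n)\<^sup>2 * recolouring_sum n r" .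
  qed
  also have "\<dots> = 24 * (fact n)\<^sup>2 * (\<Sum>r\<in>partitions 4. recolouring_sum n r / Sym 4 r)"
    by (simp add: sum_distrib_left fact_numeral mult_ac)
  finally show ?thesis by simp
qed

section \<open>Reduction of the double sums over partitions\<close>

lemma power_type_1: "power_type 1 p = p"
  by (rule poly_mapping_eqI)
    (simp add: lookup_power_type[OF finite_keys subset_refl] in_keys_iff)

text \<open>Grouping p by its image q: the weights 1/Sym(p) in one fibre add up to the coefficient
  of \<open>Zpow k\<close> at q.\<close>

lemma sum_power_type:
  assumes "k > 0"
  shows "(\<Sum>p\<in>partitions n. g (power_type k p) / Sym n p) =
    (\<Sum>q\<in>partitions n. g q * Coeff (Zpow k) n q)"
proof -
  have "(\<Sum>p\<in>partitions n. g (power_type k p) / Sym n p) =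
      (\<Sum>q\<in>partitions n. \<Sum>p | p \<in> partitions n \<and> power_type k p = q. g (power_type k p) / Sym n p)"
    using power_type_in_partitions[OF _ assms]
    by (intro sum.group[symmetric]) (auto simp: finite_partitions)
  also have "\<dots> = (\<Sum>q\<in>partitions n. g q * Coeff (Zpow k) n q)"
  proof (intro sum.cong refl)
    fix q
    have "(\<Sum>p | p \<in> partitions n \<and> power_type k p = q. g (power_type k p) / Sym n p) =
        (\<Sum>p | p \<in> partitions n \<and> power_type k p = q. g q * (1 / Sym n p))"
      by (intro sum.cong) auto
    also have "\<dots> = (\<Sum>p\<in>partitions n. if power_type k p = q then g q * (1 / Sym n p) else 0)"
      by (rule sum.inter_filter[OF finite_partitions])
    also have "\<dots> = g q * Coeff (Zpow k) n q"
      unfolding Coeff_Zpow sum_distrib_left by (intro sum.cong) auto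
    finally show "(\<Sum>p | p \<in> partitions n \<and> power_type k p = q. g (power_type k p) / Sym n p) =
        g q * Coeff (Zpow k) n q" .
  qed
  finally show ?thesis .
qed

text \<open>The case of a recolouring with m cycles, all of length k. The condition is that p and q
  have the same image: summing over q yields one coefficient, summing over p by fibres yields the
  second, hence the square. Positive m keeps the power of a zero weight zero.\<close>

lemma sum_common_power_weight:
  assumes "k > 0" "m > 0"
  shows "(\<Sum>p\<in>partitions n. \<Sum>q\<in>partitions n.
      common_power_weight n k p q ^ m / (Sym n p * Sym n q)) =
    (\<Sum>q\<in>partitions n. Sym n q ^ m * (Coeff (Zpow k) n q)\<^sup>2)"
proof -
  have "(\<Sum>q\<in>partitions n. common_power_weight n k p q ^ m / (Sym n p * Sym n q)) =
      Sym n (power_type k p) ^ m * Coeff (Zpow k) n (power_type k p) / Sym n p" for p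
    unfolding Coeff_Zpow common_power_weight_def sum_distrib_left sum_divide_distrib
    using assms(2) by (intro sum.cong) auto
  then show ?thesis
    using sum_power_type[OF assms(1), of "\<lambda>p. Sym n p ^ m * Coeff (Zpow k) n p" n]
    by (simp add: power2_eq_square mult_ac)
qed

text \<open>A recolouring with a fixed point, here \<open>Suc m\<close> of them, forces p = q, so
  that only the diagonal survives. The weights of the longer cycles are collected in
  \<open>h\<close>.\<close>

lemma sum_common_power_weight_1:
  "(\<Sum>p\<in>partitions n. \<Sum>q\<in>partitions n.
      common_power_weight n 1 p q ^ Suc m * h p q / (Sym n p * Sym n q)) =
    (\<Sum>p\<in>partitions n. Sym n p ^ Suc m * h p p / (Sym n p)\<^sup>2)"
proof (intro sum.cong refl)
  fix p assume p: "p \<in> partitions n"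
  have "(\<Sum>q\<in>partitions n. common_power_weight n 1 p q ^ Suc m * h p q / (Sym n p * Sym n q)) =
      (\<Sum>q\<in>partitions n. if p = q then Sym n p ^ Suc m * h p p / (Sym n p * Sym n p) else 0)"
    by (intro sum.cong) (auto simp: common_power_weight_def power_type_1)
  also have "\<dots> = Sym n p ^ Suc m * h p p / (Sym n p)\<^sup>2"
    using p by (simp add: finite_partitions power2_eq_square)
  finally show "(\<Sum>q\<in>partitions n. common_power_weight n 1 p q ^ Suc m * h p q /
      (Sym n p * Sym n q)) = \<dots>" .
qed

lemma prod_1_to_4: "(\<Prod>i=1..4. f i) = f 1 * f 2 * f 3 * (f 4 :: rat)" for f :: "nat \<Rightarrow> rat"
proof -
  have "{1..4::nat} = {1, 2, 3, 4}" by auto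
  then show ?thesis by (simp add: mult.assoc)
qed

lemma sum_1_to_4: "(\<Sum>i=1..4. f i) = f 1 + f 2 + f 3 + (f 4 :: nat)" for f :: "nat \<Rightarrow> nat"
proof -
  have "{1..4::nat} = {1, 2, 3, 4}" by auto
  then show ?thesis by (simp add: add.assoc)
qed

section \<open>The five cycle types in S_4\<close>

lemma recolouring_sum_1_1_1_1:
  "recolouring_sum n (Poly_Mapping.single 1 4) = (\<Sum>p\<in>partitions n. (Sym n p)\<^sup>2)"
proof -
  have "recolouring_sum n (Poly_Mapping.single 1 4) = (\<Sum>p\<in>partitions n. \<Sum>q\<in>partitions n.
      common_power_weight n 1 p q ^ Suc 3 * 1 / (Sym n p * Sym n q))"
    unfolding recolouring_sum_def prod_1_to_4 by (simp add: lookup_single)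
  also have "\<dots> = (\<Sum>p\<in>partitions n. Sym n p ^ Suc 3 * 1 / (Sym n p)\<^sup>2)"
    by (rule sum_common_power_weight_1)
  also have "\<dots> = (\<Sum>p\<in>partitions n. (Sym n p)\<^sup>2)"
  proof (intro sum.cong refl)
    fix p show "Sym n p ^ Suc 3 * 1 / (Sym n p)\<^sup>2 = (Sym n p)\<^sup>2"
      using Sym_pos[of n p] by (simp add: power2_eq_square power_numeral_reduce)
  qed
  finally show ?thesis .
qed

lemma recolouring_sum_2_1_1:
  "recolouring_sum n (Poly_Mapping.single 1 2 + Poly_Mapping.single 2 1) =
    (\<Sum>p\<in>partitions n. Sym n (power_type 2 p))"
proof -
  have "recolouring_sum n (Poly_Mapping.single 1 2 + Poly_Mapping.single 2 1) =
      (\<Sum>p\<in>partitions n. \<Sum>q\<in>partitions n.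
      common_power_weight n 1 p q ^ Suc 1 * common_power_weight n 2 p q / (Sym n p * Sym n q))"
    unfolding recolouring_sum_def prod_1_to_4
    by (simp add: lookup_single lookup_add power2_eq_square)
  also have "\<dots> = (\<Sum>p\<in>partitions n. Sym n p ^ Suc 1 * common_power_weight n 2 p p / (Sym n p)\<^sup>2)"
    by (rule sum_common_power_weight_1)
  also have "\<dots> = (\<Sum>p\<in>partitions n. Sym n (power_type 2 p))"
  proof (intro sum.cong refl)
    fix p show "Sym n p ^ Suc 1 * common_power_weight n 2 p p / (Sym n p)\<^sup>2 = Sym n (power_type 2 p)"
      using Sym_pos[of n p] by (simp add: power2_eq_square common_power_weight_def)
  qed
  finally show ?thesis .
qed

lemma recolouring_sum_3_1:
  "recolouring_sum n (Poly_Mapping.single 1 1 + Poly_Mapping.single 3 1) =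
    (\<Sum>p\<in>partitions n. Sym n (power_type 3 p) / Sym n p)"
proof -
  have "recolouring_sum n (Poly_Mapping.single 1 1 + Poly_Mapping.single 3 1) =
      (\<Sum>p\<in>partitions n. \<Sum>q\<in>partitions n.
      common_power_weight n 1 p q ^ Suc 0 * common_power_weight n 3 p q / (Sym n p * Sym n q))"
    unfolding recolouring_sum_def prod_1_to_4
    by (simp add: lookup_single lookup_add)
  also have "\<dots> = (\<Sum>p\<in>partitions n. Sym n p ^ Suc 0 * common_power_weight n 3 p p / (Sym n p)\<^sup>2)"
    by (rule sum_common_power_weight_1)
  also have "\<dots> = (\<Sum>p\<in>partitions n. Sym n (power_type 3 p) / Sym n p)"
  proof (intro sum.cong refl)
    fix p show "Sym n p ^ Suc 0 * common_power_weight n 3 p p / (Sym n p)\<^sup>2 =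
        Sym n (power_type 3 p) / Sym n p"
      using Sym_pos[of n p] by (simp add: power2_eq_square common_power_weight_def)
  qed
  finally show ?thesis .
qed

lemma recolouring_sum_2_2:
  "recolouring_sum n (Poly_Mapping.single 2 2) =
    (\<Sum>p\<in>partitions n. (Coeff (Zpow 2) n p * Sym n p)\<^sup>2)"
proof -
  have "recolouring_sum n (Poly_Mapping.single 2 2) = (\<Sum>p\<in>partitions n. \<Sum>q\<in>partitions n.
      common_power_weight n 2 p q ^ 2 / (Sym n p * Sym n q))"
    unfolding recolouring_sum_def prod_1_to_4 by (simp add: lookup_single)
  also have "\<dots> = (\<Sum>q\<in>partitions n. Sym n q ^ 2 * (Coeff (Zpow 2) n q)\<^sup>2)"
    by (rule sum_common_power_weight) simp_all
  finally show ?thesis by (simp add: power_mult_distrib mult.commute)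
qed

lemma recolouring_sum_4:
  "recolouring_sum n (Poly_Mapping.single 4 1) =
    (\<Sum>p\<in>partitions n. (Coeff (Zpow 4) n p)\<^sup>2 * Sym n p)"
proof -
  have "recolouring_sum n (Poly_Mapping.single 4 1) = (\<Sum>p\<in>partitions n. \<Sum>q\<in>partitions n.
      common_power_weight n 4 p q ^ 1 / (Sym n p * Sym n q))"
    unfolding recolouring_sum_def prod_1_to_4 by (simp add: lookup_single)
  also have "\<dots> = (\<Sum>q\<in>partitions n. Sym n q ^ 1 * (Coeff (Zpow 4) n q)\<^sup>2)"
    by (rule sum_common_power_weight) simp_all
  finally show ?thesis by (simp add: mult.commute)
qed

lemma partitions_4:
  "partitions 4 = {Poly_Mapping.single 1 4, Poly_Mapping.single 1 2 + Poly_Mapping.single 2 1,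
    Poly_Mapping.single 1 1 + Poly_Mapping.single 3 1, Poly_Mapping.single 2 2,
    Poly_Mapping.single 4 1}"
proof (intro equalityI subsetI)
  fix p assume p: "p \<in> partitions 4"
  let ?l = "Poly_Mapping.lookup p"
  have s: "?l 1 + 2 * ?l 2 + 3 * ?l 3 + 4 * ?l 4 = 4"
    using p unfolding partitions_def sum_1_to_4 by simp
  have eqI: "p = q" if "Poly_Mapping.lookup q 1 = ?l 1" "Poly_Mapping.lookup q 2 = ?l 2"
    "Poly_Mapping.lookup q 3 = ?l 3" "Poly_Mapping.lookup q 4 = ?l 4"
    "\<And>i. i \<notin> {1, 2, 3, 4} \<Longrightarrow> Poly_Mapping.lookup q i = 0" for q
  proof (rule poly_mapping_eqI)
    fix i :: nat
    have "i \<in> {1, 2, 3, 4} \<or> i \<notin> {1..4}" by auto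
    then show "?l i = Poly_Mapping.lookup q i"
      using that partitions_lookup_eq_0[OF p, of i] by (cases "i \<in> {1, 2, 3, 4}") auto
  qed
  have "(?l 1 = 4 \<and> ?l 2 = 0 \<and> ?l 3 = 0 \<and> ?l 4 = 0) \<or> (?l 1 = 2 \<and> ?l 2 = 1 \<and> ?l 3 = 0 \<and> ?l 4 = 0) \<or>
    (?l 1 = 1 \<and> ?l 2 = 0 \<and> ?l 3 = 1 \<and> ?l 4 = 0) \<or> (?l 1 = 0 \<and> ?l 2 = 2 \<and> ?l 3 = 0 \<and> ?l 4 = 0) \<or>
    (?l 1 = 0 \<and> ?l 2 = 0 \<and> ?l 3 = 0 \<and> ?l 4 = 1)"
    using s by presburger
  then show "p \<in> {Poly_Mapping.single 1 4, Poly_Mapping.single 1 2 + Poly_Mapping.single 2 1,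
    Poly_Mapping.single 1 1 + Poly_Mapping.single 3 1, Poly_Mapping.single 2 2,
    Poly_Mapping.single 4 1}"
  proof (elim disjE conjE)
    assume "?l 1 = 4" "?l 2 = 0" "?l 3 = 0" "?l 4 = 0"
    then have "p = Poly_Mapping.single 1 4"
      by (intro eqI) (simp_all add: lookup_single when_def)
    then show ?thesis by simp
  next
    assume "?l 1 = 2" "?l 2 = 1" "?l 3 = 0" "?l 4 = 0"
    then have "p = Poly_Mapping.single 1 2 + Poly_Mapping.single 2 1"
      by (intro eqI) (simp_all add: lookup_single lookup_add when_def)
    then show ?thesis by simp
  next
    assume "?l 1 = 1" "?l 2 = 0" "?l 3 = 1" "?l 4 = 0"
    then have "p = Poly_Mapping.single 1 1 + Poly_Mapping.single 3 1"
      by (intro eqI) (simp_all add: lookup_single lookup_add when_def)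
    then show ?thesis by simp
  next
    assume "?l 1 = 0" "?l 2 = 2" "?l 3 = 0" "?l 4 = 0"
    then have "p = Poly_Mapping.single 2 2"
      by (intro eqI) (simp_all add: lookup_single when_def)
    then show ?thesis by simp
  next
    assume "?l 1 = 0" "?l 2 = 0" "?l 3 = 0" "?l 4 = 1"
    then have "p = Poly_Mapping.single 4 1"
      by (intro eqI) (simp_all add: lookup_single when_def)
    then show ?thesis by simp
  qed
next
  fix p :: "nat \<Rightarrow>\<^sub>0 nat"
  assume "p \<in> {Poly_Mapping.single 1 4, Poly_Mapping.single 1 2 + Poly_Mapping.single 2 1,
    Poly_Mapping.single 1 1 + Poly_Mapping.single 3 1, Poly_Mapping.single 2 2,
    Poly_Mapping.single 4 1}"
  then show "p \<in> partitions 4"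
    unfolding partitions_def sum_1_to_4
    by (auto simp: lookup_single lookup_add in_keys_iff when_def split: if_splits)
qed

text \<open>The five coefficients are the reciprocals of \<open>Sym 4\<close>, that is, the
  frequencies of the cycle types in S_4.\<close>

lemma sum_partitions_4:
  "(\<Sum>r\<in>partitions 4. h r / Sym 4 r) =
    1/24 * h (Poly_Mapping.single 1 4) + 1/4 * h (Poly_Mapping.single 1 2 + Poly_Mapping.single 2 1) +
    1/3 * h (Poly_Mapping.single 1 1 + Poly_Mapping.single 3 1) + 1/8 * h (Poly_Mapping.single 2 2) +
    1/4 * h (Poly_Mapping.single 4 1)"
proof -
  have S: "Sym 4 (Poly_Mapping.single 1 4) = 24"
    "Sym 4 (Poly_Mapping.single 1 2 + Poly_Mapping.single 2 1) = 4"
    "Sym 4 (Poly_Mapping.single 1 1 + Poly_Mapping.single 3 1) = 3"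
    "Sym 4 (Poly_Mapping.single 2 2) = 8" "Sym 4 (Poly_Mapping.single 4 1) = 4"
    unfolding Sym_def prod_1_to_4 by (simp_all add: lookup_single lookup_add fact_numeral)
  \<comment> \<open>The five partitions of 4 already differ in their multiplicities of 1 and
    2.\<close>
  have ne: "p \<noteq> q" if "Poly_Mapping.lookup p 1 \<noteq> Poly_Mapping.lookup q 1 \<or>
    Poly_Mapping.lookup p 2 \<noteq> Poly_Mapping.lookup q 2" for p q :: "nat \<Rightarrow>\<^sub>0 nat"
    using that by auto
  show ?thesis
    unfolding partitions_4
    by (subst sum.insert, simp, simp add: ne lookup_single lookup_add)+ (simp add: S)
qed

section \<open>The sums over the symmetric group\<close>

text \<open>The delta function selects the \<sigma> commuting with g, so the sum is the order of the
  centralizer.\<close>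

lemma sum_perm_delta_commute:
  assumes g: "g \<in> perms n"
  shows "(\<Sum>\<sigma>\<in>perms n. perm_delta (g \<circ> \<sigma> \<circ> inv g \<circ> inv \<sigma>)) = Sym n (cycle_type n g)"
proof -
  have "g \<circ> \<sigma> \<circ> inv g \<circ> inv \<sigma> = id \<longleftrightarrow> \<sigma> \<circ> g = g \<circ> \<sigma>" if \<sigma>: "\<sigma> \<in> perms n" for \<sigma>
  proof
    assume eq: "g \<circ> \<sigma> \<circ> inv g \<circ> inv \<sigma> = id"
    have "g \<circ> \<sigma> = (g \<circ> \<sigma> \<circ> inv g \<circ> inv \<sigma>) \<circ> (\<sigma> \<circ> g)"
      by (simp only: comp_assoc perms_cancel[OF \<sigma>] perms_inv_comp[OF g] comp_id)
    then show "\<sigma> \<circ> g = g \<circ> \<sigma>" by (simp only: eq id_comp)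
  next
    assume "\<sigma> \<circ> g = g \<circ> \<sigma>"
    then have "g \<circ> \<sigma> \<circ> inv g \<circ> inv \<sigma> = (\<sigma> \<circ> g) \<circ> inv g \<circ> inv \<sigma>" by (simp only:)
    also have "\<dots> = id" by (simp only: comp_assoc perms_cancel[OF g] perms_inv_comp[OF \<sigma>])
    finally show "g \<circ> \<sigma> \<circ> inv g \<circ> inv \<sigma> = id" .
  qed
  then have "(\<Sum>\<sigma>\<in>perms n. perm_delta (g \<circ> \<sigma> \<circ> inv g \<circ> inv \<sigma>)) =
      (\<Sum>\<sigma>\<in>perms n. if \<sigma> \<circ> g = g \<circ> \<sigma> then 1 else 0)"
    unfolding perm_delta_def by (intro sum.cong refl if_cong)
  also have "\<dots> = of_nat (card {\<sigma> \<in> perms n. \<sigma> \<circ> g = g \<circ> \<sigma>})"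
    by (simp add: sum.If_cases finite_perms Int_def)
  finally show ?thesis by (simp add: card_intertwining_perms[OF g g])
qed

text \<open>The delta function selects the k-th roots of g^-k, and these are as many as those of g^k
  because inversion preserves the cycle type.\<close>

lemma sum_perm_delta_roots:
  assumes g: "g \<in> perms n" and "k > 0"
  shows "(\<Sum>\<sigma>\<in>perms n. perm_delta (\<sigma> ^^ k \<circ> g ^^ k)) =
    Coeff (Zpow k) n (cycle_type n (g ^^ k)) * Sym n (cycle_type n (g ^^ k))"
proof -
  have gk: "g ^^ k \<in> perms n" by (rule perms_funpow[OF g])
  have "\<sigma> ^^ k \<circ> g ^^ k = id \<longleftrightarrow> \<sigma> ^^ k = inv (g ^^ k)" for \<sigma>
  proof
    assume "\<sigma> ^^ k \<circ> g ^^ k = id"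
    then have "\<sigma> ^^ k \<circ> g ^^ k \<circ> inv (g ^^ k) = inv (g ^^ k)" by simp
    then show "\<sigma> ^^ k = inv (g ^^ k)" by (simp only: comp_assoc perms_inv_comp[OF gk] comp_id)
  qed (simp only: perms_inv_comp[OF gk])
  then have "(\<Sum>\<sigma>\<in>perms n. perm_delta (\<sigma> ^^ k \<circ> g ^^ k)) =
      (\<Sum>\<sigma>\<in>perms n. if \<sigma> ^^ k = inv (g ^^ k) then 1 else 0)"
    unfolding perm_delta_def by (intro sum.cong refl if_cong)
  also have "\<dots> = of_nat (card {\<sigma> \<in> perms n. \<sigma> ^^ k = inv (g ^^ k)})"
    by (simp add: sum.If_cases finite_perms Int_def)
  finally show ?thesis
    by (simp add: card_roots[OF perms_inv[OF gk] assms(2)] cycle_type_inv[OF gk])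
qed

text \<open>For fixed \<gamma> the sum over triples factors into three centralizer orders; the
  frequency 1/Sym(p) of the class of \<gamma> takes one of them away.\<close>

lemma S4_1_1_1_1_eq: "S4_1_1_1_1 n = (\<Sum>p\<in>partitions n. (Sym n p)\<^sup>2)"
proof -
  have "(\<Sum>\<sigma>\<in>{2..4::nat} \<rightarrow>\<^sub>E perms n. \<Prod>a=2..4. perm_delta (inv \<gamma> \<circ> \<sigma> a \<circ> \<gamma> \<circ> inv (\<sigma> a))) =
      Sym n (cycle_type n \<gamma>) ^ 3" if \<gamma>: "\<gamma> \<in> perms n" for \<gamma>
  proof -
    have "inv (inv \<gamma>) = \<gamma>" using \<gamma> by (simp add: perms_def permutes_inv_inv)
    then have "(\<Sum>\<sigma>\<in>perms n. perm_delta (inv \<gamma> \<circ> \<sigma> \<circ> \<gamma> \<circ> inv \<sigma>)) = Sym n (cycle_type n \<gamma>)"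
      using sum_perm_delta_commute[OF perms_inv[OF \<gamma>]] by (simp only: cycle_type_inv[OF \<gamma>])
    moreover have "(\<Sum>\<sigma>\<in>{2..4::nat} \<rightarrow>\<^sub>E perms n. \<Prod>a=2..4. perm_delta (inv \<gamma> \<circ> \<sigma> a \<circ> \<gamma> \<circ> inv (\<sigma> a))) =
        (\<Prod>a=2..4::nat. \<Sum>\<sigma>\<in>perms n. perm_delta (inv \<gamma> \<circ> \<sigma> \<circ> \<gamma> \<circ> inv \<sigma>))"
      by (rule prod_sum_PiE[symmetric]) (simp_all add: finite_perms)
    ultimately show ?thesis by simp
  qed
  then have "S4_1_1_1_1 n = 1 / fact n * (\<Sum>\<gamma>\<in>perms n. Sym n (cycle_type n \<gamma>) ^ 3)"
    unfolding S4_1_1_1_1_def by (intro arg_cong2[where f = "(*)"] refl sum.cong)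
  also have "\<dots> = (\<Sum>p\<in>partitions n. Sym n p ^ 3 / Sym n p)"
    unfolding sum_perms_cycle_type[of "\<lambda>p. Sym n p ^ 3"] by simp
  also have "\<dots> = (\<Sum>p\<in>partitions n. (Sym n p)\<^sup>2)"
  proof (intro sum.cong refl)
    fix p show "Sym n p ^ 3 / Sym n p = (Sym n p)\<^sup>2"
      using Sym_pos[of n p] by (simp add: power2_eq_square power3_eq_cube)
  qed
  finally show ?thesis .
qed

lemma S4_2_1_1_eq: "S4_2_1_1 n = (\<Sum>p\<in>partitions n. Sym n (power_type 2 p))"
proof -
  have "(\<Sum>\<sigma>\<^sub>1\<in>perms n. \<Sum>\<sigma>\<^sub>2\<in>perms n. perm_delta (\<gamma> \<circ> \<sigma>\<^sub>1 \<circ> inv \<gamma> \<circ> inv \<sigma>\<^sub>1) *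
      perm_delta (\<gamma> ^^ 2 \<circ> \<sigma>\<^sub>2 \<circ> inv \<gamma> ^^ 2 \<circ> inv \<sigma>\<^sub>2)) =
      Sym n (cycle_type n \<gamma>) * Sym n (power_type 2 (cycle_type n \<gamma>))" if \<gamma>: "\<gamma> \<in> perms n" for \<gamma>
    unfolding sum_product[symmetric] inv_funpow_perms[OF \<gamma>, symmetric]
      sum_perm_delta_commute[OF \<gamma>] sum_perm_delta_commute[OF perms_funpow[OF \<gamma>]]
    by (simp add: cycle_type_funpow[OF \<gamma>])
  then have "S4_2_1_1 n = 1 / fact n *
      (\<Sum>\<gamma>\<in>perms n. Sym n (cycle_type n \<gamma>) * Sym n (power_type 2 (cycle_type n \<gamma>)))"
    unfolding S4_2_1_1_def by (intro arg_cong2[where f = "(*)"] refl sum.cong)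
  also have "\<dots> = (\<Sum>p\<in>partitions n. Sym n p * Sym n (power_type 2 p) / Sym n p)"
    unfolding sum_perms_cycle_type[of "\<lambda>p. Sym n p * Sym n (power_type 2 p)"] by simp
  also have "\<dots> = (\<Sum>p\<in>partitions n. Sym n (power_type 2 p))"
  proof (intro sum.cong refl)
    fix p show "Sym n p * Sym n (power_type 2 p) / Sym n p = Sym n (power_type 2 p)"
      using Sym_pos[of n p] by simp
  qed
  finally show ?thesis .
qed

lemma S4_3_1_eq: "S4_3_1 n = (\<Sum>p\<in>partitions n. Sym n (power_type 3 p) / Sym n p)"
proof -
  have "(\<Sum>\<sigma>\<in>perms n. perm_delta (\<gamma> ^^ 3 \<circ> \<sigma> \<circ> inv \<gamma> ^^ 3 \<circ> inv \<sigma>)) =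
      Sym n (power_type 3 (cycle_type n \<gamma>))" if \<gamma>: "\<gamma> \<in> perms n" for \<gamma>
    unfolding inv_funpow_perms[OF \<gamma>, symmetric] sum_perm_delta_commute[OF perms_funpow[OF \<gamma>]]
    by (simp add: cycle_type_funpow[OF \<gamma>])
  then have "S4_3_1 n = 1 / fact n * (\<Sum>\<gamma>\<in>perms n. Sym n (power_type 3 (cycle_type n \<gamma>)))"
    unfolding S4_3_1_def by (intro arg_cong2[where f = "(*)"] refl sum.cong)
  also have "\<dots> = (\<Sum>p\<in>partitions n. Sym n (power_type 3 p) / Sym n p)"
    unfolding sum_perms_cycle_type[of "\<lambda>p. Sym n (power_type 3 p)"] by simp
  finally show ?thesis .
qed

text \<open>For fixed \<gamma> the first delta function counts square roots and the second a
  centralizer. Both depend only on the type of \<gamma>^2, and summing over \<gamma> by that type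
  brings in the second coefficient.\<close>

lemma S4_2_2_eq: "S4_2_2 n = (\<Sum>p\<in>partitions n. (Coeff (Zpow 2) n p * Sym n p)\<^sup>2)"
proof -
  let ?h = "\<lambda>q. Coeff (Zpow 2) n q * Sym n q * Sym n q"
  have "(\<Sum>\<sigma>\<^sub>1\<in>perms n. \<Sum>\<sigma>\<^sub>2\<in>perms n. perm_delta (\<sigma>\<^sub>1 ^^ 2 \<circ> \<gamma> ^^ 2) *
      perm_delta (\<gamma> ^^ 2 \<circ> \<sigma>\<^sub>2 \<circ> inv \<gamma> ^^ 2 \<circ> inv \<sigma>\<^sub>2)) =
      ?h (power_type 2 (cycle_type n \<gamma>))" if \<gamma>: "\<gamma> \<in> perms n" for \<gamma>
    unfolding sum_product[symmetric] inv_funpow_perms[OF \<gamma>, symmetric]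
      sum_perm_delta_roots[OF \<gamma> zero_less_numeral] sum_perm_delta_commute[OF perms_funpow[OF \<gamma>]]
    by (simp add: cycle_type_funpow[OF \<gamma>])
  then have "S4_2_2 n = 1 / fact n * (\<Sum>\<gamma>\<in>perms n. ?h (power_type 2 (cycle_type n \<gamma>)))"
    unfolding S4_2_2_def by (intro arg_cong2[where f = "(*)"] refl sum.cong)
  also have "\<dots> = (\<Sum>p\<in>partitions n. ?h (power_type 2 p) / Sym n p)"
    unfolding sum_perms_cycle_type[of "\<lambda>p. ?h (power_type 2 p)"] by simp
  also have "\<dots> = (\<Sum>q\<in>partitions n. ?h q * Coeff (Zpow 2) n q)"
    by (rule sum_power_type) simp
  finally show ?thesis by (simp add: power2_eq_square mult_ac)
qed

lemma S4_4_eq: "S4_4 n = (\<Sum>p\<in>partitions n. (Coeff (Zpow 4) n p)\<^sup>2 * Sym n p)"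
proof -
  let ?h = "\<lambda>q. Coeff (Zpow 4) n q * Sym n q"
  have "(\<Sum>\<sigma>\<in>perms n. perm_delta (\<sigma> ^^ 4 \<circ> \<gamma> ^^ 4)) = ?h (power_type 4 (cycle_type n \<gamma>))"
    if \<gamma>: "\<gamma> \<in> perms n" for \<gamma>
    unfolding sum_perm_delta_roots[OF \<gamma> zero_less_numeral] by (simp add: cycle_type_funpow[OF \<gamma>])
  then have "S4_4 n = 1 / fact n * (\<Sum>\<gamma>\<in>perms n. ?h (power_type 4 (cycle_type n \<gamma>)))"
    unfolding S4_4_def by (intro arg_cong2[where f = "(*)"] refl sum.cong)
  also have "\<dots> = (\<Sum>p\<in>partitions n. ?h (power_type 4 p) / Sym n p)"
    unfolding sum_perms_cycle_type[of "\<lambda>p. ?h (power_type 4 p)"] by simp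
  also have "\<dots> = (\<Sum>q\<in>partitions n. ?h q * Coeff (Zpow 4) n q)"
    by (rule sum_power_type) simp
  finally show ?thesis by (simp add: power2_eq_square mult_ac)
qed

section \<open>The explicit product for squares\<close>

lemma lookup_power_type_2:
  "Poly_Mapping.lookup (power_type 2 p) j =
    (if odd j then Poly_Mapping.lookup p j else 0) + 2 * Poly_Mapping.lookup p (2 * j)"
proof -
  \<comment> \<open>Contains both j and 2j even if they are not parts of p, so that the two delta
    sums below can be evaluated.\<close>
  let ?I = "insert j (insert (2 * j) (Poly_Mapping.keys p))"
  have gcd2: "gcd i 2 = (if even i then 2 else 1)" for i :: nat
    by (simp add: gcd_nat.absorb2 coprime_iff_gcd_eq_1[symmetric])
  have "Poly_Mapping.lookup (power_type 2 p) j =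
      (\<Sum>i\<in>?I. if i div gcd i 2 = j then gcd i 2 * Poly_Mapping.lookup p i else 0)"
    by (rule lookup_power_type) auto
  \<comment> \<open>A j-cycle of a square is either an odd j-cycle of the permutation, left whole,
    or one half of a 2j-cycle.\<close>
  also have "\<dots> = (\<Sum>i\<in>?I. (if i = j then if odd j then Poly_Mapping.lookup p j else 0 else 0) +
      (if i = 2 * j then 2 * Poly_Mapping.lookup p (2 * j) else 0))"
    by (intro sum.cong refl) (auto simp: gcd2)
  also have "\<dots> = (if odd j then Poly_Mapping.lookup p j else 0) + 2 * Poly_Mapping.lookup p (2 * j)"
    by (simp add: sum.distrib del: sum.insert sum.insert_if)
  finally show ?thesis .
qed

text \<open>The product is split by the parity of the cycle length. For even n the odd range ends at
  n + 1, where the multiplicity is 0 and the factor is 1.\<close>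

lemma Sym_power_type_2:
  assumes "p \<in> partitions n"
  shows "Sym n (power_type 2 p) =
    (\<Prod>j=1..n div 2. of_nat (2*j) ^ (2 * Poly_Mapping.lookup p (4*j)) * fact (2 * Poly_Mapping.lookup p (4*j))) *
    (\<Prod>j=0..n div 2. of_nat (2*j+1) ^ (Poly_Mapping.lookup p (2*j+1) + 2 * Poly_Mapping.lookup p (4*j+2)) *
      fact (Poly_Mapping.lookup p (2*j+1) + 2 * Poly_Mapping.lookup p (4*j+2)))"
proof -
  let ?q = "power_type 2 p"
  let ?w = "\<lambda>i. of_nat i ^ Poly_Mapping.lookup ?q i * fact (Poly_Mapping.lookup ?q i) :: rat"
  let ?E = "(\<lambda>j. 2 * j) ` {1..n div 2}" and ?O = "(\<lambda>j. 2 * j + 1) ` {0..n div 2}"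
  have q: "?q \<in> partitions n" by (rule power_type_in_partitions[OF assms]) simp
  have cover: "{1..n} \<subseteq> ?E \<union> ?O"
  proof
    fix i assume i: "i \<in> {1..n}"
    show "i \<in> ?E \<union> ?O"
    proof (cases "even i")
      case True
      then have "i = 2 * (i div 2)" "i div 2 \<in> {1..n div 2}" using i by (auto elim!: evenE)
      then show ?thesis by blast
    next
      case False
      then have "i = 2 * (i div 2) + 1" "i div 2 \<in> {0..n div 2}" using i by (auto intro: div_le_mono)
      then show ?thesis by blast
    qed
  qed
  have "Sym n ?q = (\<Prod>i\<in>?E \<union> ?O. ?w i)"
    by (rule Sym_superset[OF q]) (use partitions_keys[OF q] cover in auto)
  also have "\<dots> = (\<Prod>i\<in>?E. ?w i) * (\<Prod>i\<in>?O. ?w i)"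
    by (rule prod.union_disjoint) (auto, presburger)
  also have "(\<Prod>i\<in>?E. ?w i) = (\<Prod>j=1..n div 2. ?w (2 * j))"
    by (subst prod.reindex) (auto simp: inj_on_def)
  also have "(\<Prod>i\<in>?O. ?w i) = (\<Prod>j=0..n div 2. ?w (2 * j + 1))"
    by (subst prod.reindex) (auto simp: inj_on_def)
  finally have *: "Sym n ?q = (\<Prod>j=1..n div 2. ?w (2 * j)) * (\<Prod>j=0..n div 2. ?w (2 * j + 1))" .
  have lk: "Poly_Mapping.lookup ?q (2 * j) = 2 * Poly_Mapping.lookup p (4 * j)"
    "Poly_Mapping.lookup ?q (2 * j + 1) =
      Poly_Mapping.lookup p (2 * j + 1) + 2 * Poly_Mapping.lookup p (4 * j + 2)" for j
    by (simp_all add: lookup_power_type_2)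
  show ?thesis unfolding * lk ..
qed

section \<open>The three substitutions as cases of \<open>Zpow\<close>\<close>

lemma Z2_eq_Zpow: "Z2 = Zpow 2"
proof -
  have "(if even i then xvar (i div 2) ^ 2 else xvar i) = xvar (i div gcd i 2) ^ gcd i 2" for i
    by (cases "even i") (simp_all add: gcd_nat.absorb2 coprime_iff_gcd_eq_1[symmetric])
  then show ?thesis by (simp only: Z2_def Zpow_def)
qed

lemma Z3_eq_Zpow: "Z3 = Zpow 3"
proof -
  have "(if 3 dvd i then xvar (i div 3) ^ 3 else xvar i) = xvar (i div gcd i 3) ^ gcd i 3" for i
  proof -
    have g: "gcd i 3 = gcd 3 (i mod 3)" by (rule gcd_red_nat)
    have "gcd 3 2 = (1::nat)" by (simp add: gcd_red_nat[of 3 2])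
    moreover have "i mod 3 = 0 \<or> i mod 3 = 1 \<or> i mod 3 = 2" by presburger
    ultimately have "i mod 3 = 0 \<and> gcd i 3 = 3 \<or> i mod 3 \<noteq> 0 \<and> gcd i 3 = 1"
      unfolding g by (elim disjE) simp_all
    then show ?thesis by (auto simp: dvd_eq_mod_eq_0)
  qed
  then show ?thesis by (simp only: Z3_def Zpow_def)
qed

lemma Z4_eq_Zpow: "Z4 = Zpow 4"
proof -
  have "(if i mod 4 = 0 then xvar (i div 4) ^ 4 else if i mod 4 = 2 then xvar (i div 2) ^ 2 else xvar i)
      = xvar (i div gcd i 4) ^ gcd i 4" for i
  proof -
    have g: "gcd i 4 = gcd 4 (i mod 4)" by (rule gcd_red_nat)
    have "gcd 4 2 = (2::nat)" "gcd 4 3 = (1::nat)"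
      by (simp_all add: gcd_red_nat[of 4 2] gcd_red_nat[of 4 3])
    moreover have "i mod 4 = 0 \<or> i mod 4 = 1 \<or> i mod 4 = 2 \<or> i mod 4 = 3" by presburger
    ultimately have "i mod 4 = 0 \<and> gcd i 4 = 4 \<or> i mod 4 = 2 \<and> gcd i 4 = 2 \<or>
        i mod 4 \<noteq> 0 \<and> i mod 4 \<noteq> 2 \<and> gcd i 4 = 1"
      unfolding g by (elim disjE) simp_all
    then show ?thesis by auto
  qed
  then show ?thesis by (simp only: Z4_def Zpow_def)
qed

theorem mainTheorem6:
  fixes n :: nat
  assumes "n \<ge> 1"
  shows "(of_nat (Z4_sc n) =
           1/24 * S4_1_1_1_1 n + 1/4 * S4_2_1_1 n + 1/3 * S4_3_1 n + 1/8 * S4_2_2 n + 1/4 * S4_4 n) \<and>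
    (S4_1_1_1_1 n = (\<Sum>p\<in>partitions n. (Sym n p)^2)) \<and>
    (S4_2_1_1 n = (\<Sum>p\<in>partitions n.
           (\<Prod>j=1..n div 2. of_nat (2*j) ^ (2 * Poly_Mapping.lookup p (4*j)) * fact (2 * Poly_Mapping.lookup p (4*j))) *
           (\<Prod>j=0..n div 2. of_nat (2*j+1) ^ (Poly_Mapping.lookup p (2*j+1) + 2 * Poly_Mapping.lookup p (4*j+2)) *
              fact (Poly_Mapping.lookup p (2*j+1) + 2 * Poly_Mapping.lookup p (4*j+2))))) \<and>
    (S4_3_1 n = (\<Sum>p\<in>partitions n. Coeff Z3 n p * Sym n p)) \<and>
    (S4_2_2 n = (\<Sum>p\<in>partitions n. (Coeff Z2 n p * Sym n p)^2)) \<and>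
    (S4_4 n = (\<Sum>p\<in>partitions n. (Coeff Z4 n p)^2 * Sym n p))"
proof (intro conjI)
  show "of_nat (Z4_sc n) =
      1/24 * S4_1_1_1_1 n + 1/4 * S4_2_1_1 n + 1/3 * S4_3_1 n + 1/8 * S4_2_2 n + 1/4 * S4_4 n"
    \<comment> \<open>Both sides become the same combination of five sums over partitions.\<close>
    unfolding Z4_sc_eq_sum_recolouring sum_partitions_4
      recolouring_sum_1_1_1_1 recolouring_sum_2_1_1 recolouring_sum_3_1 recolouring_sum_2_2
      recolouring_sum_4 S4_1_1_1_1_eq S4_2_1_1_eq S4_3_1_eq S4_2_2_eq S4_4_eq ..
  show "S4_1_1_1_1 n = (\<Sum>p\<in>partitions n. (Sym n p)^2)"
    by (rule S4_1_1_1_1_eq)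
  show "S4_2_1_1 n = (\<Sum>p\<in>partitions n.
      (\<Prod>j=1..n div 2. of_nat (2*j) ^ (2 * Poly_Mapping.lookup p (4*j)) * fact (2 * Poly_Mapping.lookup p (4*j))) *
      (\<Prod>j=0..n div 2. of_nat (2*j+1) ^ (Poly_Mapping.lookup p (2*j+1) + 2 * Poly_Mapping.lookup p (4*j+2)) *
        fact (Poly_Mapping.lookup p (2*j+1) + 2 * Poly_Mapping.lookup p (4*j+2))))"
    unfolding S4_2_1_1_eq by (intro sum.cong refl Sym_power_type_2)
  show "S4_3_1 n = (\<Sum>p\<in>partitions n. Coeff Z3 n p * Sym n p)"
    \<comment> \<open>\<open>sum_power_type\<close> with \<open>Sym n\<close> as the summand: the
      weights 1/Sym(p) turn into coefficients of \<open>Zpow 3\<close>.\<close>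
    unfolding S4_3_1_eq Z3_eq_Zpow using sum_power_type[of 3 "Sym n" n] by (simp add: mult.commute)
  show "S4_2_2 n = (\<Sum>p\<in>partitions n. (Coeff Z2 n p * Sym n p)^2)"
    unfolding Z2_eq_Zpow by (rule S4_2_2_eq)
  show "S4_4 n = (\<Sum>p\<in>partitions n. (Coeff Z4 n p)^2 * Sym n p)"
    unfolding Z4_eq_Zpow by (rule S4_4_eq)
qed

end
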